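(* Let $\mathcal{G}$ be a finite groupoid, let $K$ be a field, let $\mathcal{G}^{BR}$ be the Birget-Rhodes expansion of $\mathcal{G}$, and let $\lambda : \mathcal{G} \to K\mathcal{G}^{BR}$ be the map $\lambda(g) = \sum_{A \ni g^{-1}} (A,g)$, the sum running over all $A$ with $(A,g) \in \mathcal{G}^{BR}$. Then there is a one-to-one correspondence between the partial groupoid representations of $\mathcal{G}$ and the representations of the groupoid algebra $K\mathcal{G}^{BR}$. More precisely, if $\mathcal{A}$ is any unital $K$-algebra, then a map $\pi : \mathcal{G} \to \mathcal{A}$ is a partial groupoid representation of $\mathcal{G}$ on $\mathcal{A}$ if and only if there is a homomorphism of $K$-algebras $\tilde{\pi} : K\mathcal{G}^{BR} \to \mathcal{A}$ such that $\pi = \tilde{\pi} \circ \lambda$. Moreover, such a homomorphism $\tilde{\pi}$ is unique.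
   Context: A groupoid $\mathcal{G}$ is a small category in which every morphism is an isomorphism; it is identified with its set of morphisms, and its set of objects $\mathcal{G}_0$ is regarded as a subset of $\mathcal{G}$ via identity morphisms. For $g \in \mathcal{G}$, the domain and range are $d(g) = g^{-1}g$ and $r(g) = gg^{-1}$ (elements of $\mathcal{G}_0$). The product $gh$ is defined exactly when $d(g) = r(h)$, and $\mathcal{G}_2 = \{(g,h) \in \mathcal{G}\times\mathcal{G} : gh \text{ is defined}\}$. All algebras are associative and unital, and homomorphisms of $K$-algebras preserve the unit. A partial groupoid representation of $\mathcal{G}$ on a $K$-algebra $\mathcal{A}$ is a map $\pi : \mathcal{G} \to \mathcal{A}$ such that: (i) $\pi(g)\pi(h)\pi(h^{-1}) = \pi(gh)\pi(h^{-1})$ for all $(g,h) \in \mathcal{G}_2$; (ii) $\pi(g^{-1})\pi(g)\pi(h) = \pi(g^{-1})\pi(gh)$ for all $(g,h) \in \mathcal{G}_2$; (iii) $\pi(g)\pi(g^{-1})\pi(g) = \pi(g)$ for all $g \in \mathcal{G}$; (iv) $\sum_{e \in \mathcal{G}_0} \pi(e) = 1_{\mathcal{A}}$, and $\pi(e)\pi(f) = 0$ for all $e,f \in \mathcal{G}_0$ with $e \neq f$. For $g \in \mathcal{G}$ let $Y_g = \{h \in \mathcal{G} : r(h) = d(g)\}$. The Birget-Rhodes expansion of $\mathcal{G}$ is the finite groupoid $$\mathcal{G}^{BR} = \{(A,g) : g \in \mathcal{G},\ A \subseteq Y_g,\ d(g) \in A,\ g^{-1} \in A\},$$ with partial multiplication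 $(A,g)\cdot(B,h) = (B,gh)$ if $(g,h) \in \mathcal{G}_2$ and $A = hB := \{hb : b \in B\}$, and undefined otherwise. The inverse of $(A,g)$ is $(gA,g^{-1})$, with $d(A,g) = (A,d(g))$ and $r(A,g) = (gA,r(g))$. The groupoid algebra $K\mathcal{G}^{BR}$ is the $K$-vector space with basis $\mathcal{G}^{BR}$, where the product of two basis elements is their product in $\mathcal{G}^{BR}$ if it is defined and $0$ otherwise; its unit is the sum of all $(A,e) \in \mathcal{G}^{BR}$ with $e \in \mathcal{G}_0$. A representation of $K\mathcal{G}^{BR}$ on $\mathcal{A}$ is a homomorphism of $K$-algebras $K\mathcal{G}^{BR} \to \mathcal{A}$. *)

theory Defs
  imports "HOL-Algebra.Module"
begin

section \<open>Groupoids\<close>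

text \<open>A small category is given by its set of morphisms; an object is identified with its
  identity morphism, so source and target are again morphisms.  The product of \<open>g\<close> and \<open>h\<close> is
  defined exactly when \<open>src g = trg h\<close>; the value of \<^term>\<open>cmp\<close> on other pairs is irrelevant.\<close>

record 'g groupoid =
  mor :: "'g set"
  src :: "'g \<Rightarrow> 'g"
  trg :: "'g \<Rightarrow> 'g"
  cmp :: "'g \<Rightarrow> 'g \<Rightarrow> 'g"  (infixl "\<cdot>\<index>" 70)

locale groupoid =
  fixes G :: "('g, 'x) groupoid_scheme" (structure)
  assumes src_closed: "g \<in> mor G \<Longrightarrow> src G g \<in> mor G"
    and trg_closed: "g \<in> mor G \<Longrightarrow> trg G g \<in> mor G"
    and src_src: "g \<in> mor G \<Longrightarrow> src G (src G g) = src G g"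
    and trg_src: "g \<in> mor G \<Longrightarrow> trg G (src G g) = src G g"
    and src_trg: "g \<in> mor G \<Longrightarrow> src G (trg G g) = trg G g"
    and trg_trg: "g \<in> mor G \<Longrightarrow> trg G (trg G g) = trg G g"
    and cmp_closed: "\<lbrakk>g \<in> mor G; h \<in> mor G; src G g = trg G h\<rbrakk> \<Longrightarrow> g \<cdot> h \<in> mor G"
    and src_cmp: "\<lbrakk>g \<in> mor G; h \<in> mor G; src G g = trg G h\<rbrakk> \<Longrightarrow> src G (g \<cdot> h) = src G h"
    and trg_cmp: "\<lbrakk>g \<in> mor G; h \<in> mor G; src G g = trg G h\<rbrakk> \<Longrightarrow> trg G (g \<cdot> h) = trg G g"
    and cmp_assoc: "\<lbrakk>g \<in> mor G; h \<in> mor G; k \<in> mor G; src G g = trg G h; src G h = trg G k\<rbrakk>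
          \<Longrightarrow> (g \<cdot> h) \<cdot> k = g \<cdot> (h \<cdot> k)"
    and cmp_src: "g \<in> mor G \<Longrightarrow> g \<cdot> src G g = g"
    and trg_cmp_id: "g \<in> mor G \<Longrightarrow> trg G g \<cdot> g = g"
    and iso: "g \<in> mor G \<Longrightarrow> \<exists>h\<in>mor G. src G h = trg G g \<and> trg G h = src G g \<and>
          h \<cdot> g = src G g \<and> g \<cdot> h = trg G g"

definition objs :: "('g, 'x) groupoid_scheme \<Rightarrow> 'g set" where
  "objs G = {e \<in> mor G. src G e = e}"

definition ginv :: "('g, 'x) groupoid_scheme \<Rightarrow> 'g \<Rightarrow> 'g" where
  "ginv G g = (THE h. h \<in> mor G \<and> src G h = trg G g \<and> trg G h = src G g \<and>
     h \<cdot>\<^bsub>G\<^esub> g = src G g \<and> g \<cdot>\<^bsub>G\<^esub> h = trg G g)"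

lemma (in groupoid) inverse_unique:
  assumes "g \<in> mor G" "h \<in> mor G" "k \<in> mor G"
    and "src G h = trg G g" "trg G h = src G g" "h \<cdot> g = src G g"
    and "src G k = trg G g" "trg G k = src G g" "g \<cdot> k = trg G g"
  shows "h = k"
proof -
  have "h = h \<cdot> (g \<cdot> k)" using assms by (metis cmp_src)
  also have "\<dots> = (h \<cdot> g) \<cdot> k" using cmp_assoc[of h g k] assms by metis
  also have "\<dots> = k" using assms by (metis trg_cmp_id)
  finally show ?thesis .
qed

lemma (in groupoid) ginv:
  assumes "g \<in> mor G"
  shows "ginv G g \<in> mor G" "src G (ginv G g) = trg G g" "trg G (ginv G g) = src G g"
    "ginv G g \<cdot> g = src G g" "g \<cdot> ginv G g = trg G g"
proof -
  have "\<exists>!h. h \<in> mor G \<and> src G h = trg G g \<and> trg G h = src G g \<and>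
      h \<cdot> g = src G g \<and> g \<cdot> h = trg G g"
    using iso[OF assms] inverse_unique[OF assms] by blast
  from theI'[OF this]
  show "ginv G g \<in> mor G" "src G (ginv G g) = trg G g" "trg G (ginv G g) = src G g"
    "ginv G g \<cdot> g = src G g" "g \<cdot> ginv G g = trg G g"
    unfolding ginv_def by blast+
qed

lemma (in groupoid) ginv_eqI:
  assumes "g \<in> mor G" "h \<in> mor G" "src G h = trg G g" "trg G h = src G g" "h \<cdot> g = src G g"
  shows "ginv G g = h"
  using inverse_unique[OF assms(1,2) ginv(1)[OF assms(1)]] assms ginv[OF assms(1)] by simp

lemma (in groupoid) ginv_src: "g \<in> mor G \<Longrightarrow> ginv G (src G g) = src G g"
  by (rule ginv_eqI) (use cmp_src[of "src G g"] in
      \<open>simp_all add: src_closed src_src trg_src\<close>)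


section \<open>The Birget-Rhodes expansion\<close>

definition star_at :: "('g, 'x) groupoid_scheme \<Rightarrow> 'g \<Rightarrow> 'g set" where
  "star_at G g = {h \<in> mor G. trg G h = src G g}"

text \<open>Two elements \<open>(A, g)\<close> and \<open>(B, h)\<close> are composable iff \<open>src (A, g) = trg (B, h)\<close>, that is,
  iff \<open>src g = trg h\<close> and \<open>A = hB\<close>.\<close>

definition birget_rhodes :: "('g, 'x) groupoid_scheme \<Rightarrow> ('g set \<times> 'g) groupoid" where
  "birget_rhodes G =
    \<lparr> mor = {(A, g). g \<in> mor G \<and> A \<subseteq> star_at G g \<and> src G g \<in> A \<and> ginv G g \<in> A},
      src = (\<lambda>(A, g). (A, src G g)),
      trg = (\<lambda>(A, g). ((\<lambda>a. g \<cdot>\<^bsub>G\<^esub> a) ` A, trg G g)),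
      cmp = (\<lambda>(A, g) (B, h). (B, g \<cdot>\<^bsub>G\<^esub> h)) \<rparr>"

lemma (in groupoid) groupoid_birget_rhodes: "groupoid (birget_rhodes G)"
proof -
  let ?B = "birget_rhodes G"
  note simps = birget_rhodes_def star_at_def
  have mor: "(A, g) \<in> mor ?B \<longleftrightarrow>
      g \<in> mor G \<and> (\<forall>a\<in>A. a \<in> mor G \<and> trg G a = src G g) \<and> src G g \<in> A \<and> ginv G g \<in> A" for A g
    by (auto simp: simps)
  have src: "src ?B (A, g) = (A, src G g)"
    and trg: "trg ?B (A, g) = ((\<lambda>a. g \<cdot> a) ` A, trg G g)"
    and cmp: "(A, g) \<cdot>\<^bsub>?B\<^esub> (B, h) = (B, g \<cdot> h)" for A B g h
    by (simp_all add: simps)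
  have img_id: "(\<lambda>a. src G g \<cdot> a) ` A = A" if "\<forall>a\<in>A. a \<in> mor G \<and> trg G a = src G g" for A g
  proof -
    have "src G g \<cdot> a = a" if "a \<in> A" for a
      using that trg_cmp_id[of a] \<open>\<forall>a\<in>A. _\<close> by simp
    then show ?thesis by simp
  qed
  have inv_mem: "((\<lambda>a. g \<cdot> a) ` A, ginv G g) \<in> mor ?B" if m: "(A, g) \<in> mor ?B" for A g
  proof -
    have g: "g \<in> mor G" using m by (simp add: mor)
    have "ginv G (ginv G g) = g" using ginv[OF g] g by (intro ginv_eqI) auto
    moreover have "g \<in> (\<lambda>a. g \<cdot> a) ` A"
      using m cmp_src[OF g] by (metis image_eqI mor)
    moreover have "trg G g \<in> (\<lambda>a. g \<cdot> a) ` A"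
      using m ginv(5)[OF g] by (metis image_eqI mor)
    ultimately show ?thesis
      using m g ginv[OF g] by (auto simp: mor cmp_closed trg_cmp)
  qed
  have img_img: "(\<lambda>a. h \<cdot> a) ` (\<lambda>a. g \<cdot> a) ` A = (\<lambda>a. (h \<cdot> g) \<cdot> a) ` A"
    if "h \<in> mor G" "src G h = trg G g" "(A, g) \<in> mor ?B" for A g h
    using that by (auto simp: mor cmp_assoc image_image intro!: image_cong)
  have tclosed: "((\<lambda>a. g \<cdot> a) ` A, trg G g) \<in> mor ?B" if "(A, g) \<in> mor ?B" for A g
  proof -
    have g: "g \<in> mor G" using that by (simp add: mor)
    have "ginv G (trg G g) = trg G g"
      using ginv_src[OF trg_closed[OF g]] src_trg[OF g] by simp
    moreover have "trg G g \<in> (\<lambda>a. g \<cdot> a) ` A"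
      using that ginv(5)[OF g] by (metis image_eqI mor)
    ultimately show ?thesis
      using that g by (auto simp: mor cmp_closed trg_cmp trg_closed src_trg)
  qed
  have sclosed: "(A, src G g) \<in> mor ?B" if "(A, g) \<in> mor ?B" for A g
    using that by (auto simp: mor src_closed src_src ginv_src)
  have cclosed: "(B, g \<cdot> h) \<in> mor ?B"
    if m: "(A, g) \<in> mor ?B" "(B, h) \<in> mor ?B" "src ?B (A, g) = trg ?B (B, h)" for A B g h
  proof -
    have gh: "g \<in> mor G" "h \<in> mor G" "src G g = trg G h" and A: "A = (\<lambda>a. h \<cdot> a) ` B"
      using m by (auto simp: mor src trg)
    from m(1) have "ginv G g \<in> A" by (simp add: mor)
    then obtain b where b: "b \<in> B" "ginv G g = h \<cdot> b" unfolding A by auto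
    have bm: "b \<in> mor G" "trg G b = src G h" using m(2) b(1) by (auto simp: mor)
    have "src G b = trg G g" using ginv(2)[OF gh(1)] b gh bm by (simp add: src_cmp)
    moreover have "b \<cdot> (g \<cdot> h) = src G (g \<cdot> h)"
    proof -
      have hb: "(h \<cdot> b) \<cdot> g = trg G h" using b ginv(4)[OF gh(1)] gh by simp
      have bb: "b = ginv G h \<cdot> (h \<cdot> b)"
        using ginv[OF gh(2)] bm gh trg_cmp_id[of b] by (simp add: cmp_assoc[symmetric])
      have "b \<cdot> g = ginv G h \<cdot> ((h \<cdot> b) \<cdot> g)"
        using ginv[OF gh(2)] bm gh \<open>src G b = trg G g\<close>
        by (subst bb) (simp add: cmp_assoc cmp_closed src_cmp trg_cmp)
      also have "\<dots> = ginv G h" using hb ginv[OF gh(2)] cmp_src by metis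
      finally have "b \<cdot> g = ginv G h" .
      then show ?thesis
        using ginv[OF gh(2)] bm gh \<open>src G b = trg G g\<close> by (simp add: cmp_assoc[symmetric] src_cmp)
    qed
    ultimately have "ginv G (g \<cdot> h) = b"
      using bm gh by (intro ginv_eqI) (auto simp: cmp_closed src_cmp trg_cmp)
    then show ?thesis using m gh b by (auto simp: mor cmp_closed src_cmp)
  qed
  show ?thesis
  proof (unfold_locales, goal_cases)
    case (1 x) then show ?case by (cases x) (simp add: src sclosed)
  next
    case (2 x) then show ?case by (cases x) (simp add: trg tclosed)
  next
    case (3 x) then show ?case by (cases x) (simp add: src src_src mor)
  next
    case (4 x) then show ?case by (cases x) (simp add: src trg mor trg_src img_id)
  next
    case (5 x) then show ?case by (cases x) (simp add: src trg mor src_trg)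
  next
    case (6 x)
    obtain A g where x: "x = (A, g)" by (cases x)
    have "(\<lambda>a. trg G g \<cdot> a) ` (\<lambda>a. g \<cdot> a) ` A = (\<lambda>a. g \<cdot> a) ` A"
      using img_img[of "trg G g" g A] 6 x by (simp add: mor trg_closed src_trg trg_cmp_id)
    then show ?case using 6 x by (simp add: trg mor trg_trg)
  next
    case (7 x y)
    then show ?case by (cases x; cases y) (simp add: cmp cclosed)
  next
    case (8 x y) then show ?case by (cases x; cases y) (auto simp: cmp src trg mor src_cmp)
  next
    case (9 x y)
    then show ?case
      by (cases x; cases y) (auto simp: cmp src trg mor trg_cmp img_img[symmetric])
  next
    case (10 x y z)
    then show ?case by (cases x; cases y; cases z) (auto simp: cmp src trg mor cmp_assoc)
  next
    case (11 x) then show ?case by (cases x) (simp add: cmp src mor cmp_src)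
  next
    case (12 x) then show ?case by (cases x) (simp add: cmp trg mor trg_cmp_id)
  next
    case (13 x)
    obtain A g where x: "x = (A, g)" by (cases x)
    have g: "g \<in> mor G" and A: "\<forall>a\<in>A. a \<in> mor G \<and> trg G a = src G g" using 13 x by (auto simp: mor)
    have "(\<lambda>a. ginv G g \<cdot> a) ` (\<lambda>a. g \<cdot> a) ` A = A"
      using img_img[of "ginv G g" g A] 13 x ginv[OF g] A img_id by simp
    then show ?case
      using inv_mem[of A g] 13 x ginv[OF g]
      by (intro bexI[of _ "((\<lambda>a. g \<cdot> a) ` A, ginv G g)"]) (auto simp: src trg cmp)
  qed
qed


section \<open>Algebras\<close>

text \<open>HOL-Algebra's locale \<open>algebra\<close> is restricted to commutative algebras.\<close>

locale unital_algebra = module K A + ring A for K (structure) and A (structure) +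
  assumes smult_mult_left:
      "\<lbrakk>c \<in> carrier K; x \<in> carrier A; y \<in> carrier A\<rbrakk>
        \<Longrightarrow> (c \<odot>\<^bsub>A\<^esub> x) \<otimes>\<^bsub>A\<^esub> y = c \<odot>\<^bsub>A\<^esub> (x \<otimes>\<^bsub>A\<^esub> y)"
    and smult_mult_right:
      "\<lbrakk>c \<in> carrier K; x \<in> carrier A; y \<in> carrier A\<rbrakk>
        \<Longrightarrow> x \<otimes>\<^bsub>A\<^esub> (c \<odot>\<^bsub>A\<^esub> y) = c \<odot>\<^bsub>A\<^esub> (x \<otimes>\<^bsub>A\<^esub> y)"

definition algebra_hom ::
  "('k, 'm) ring_scheme \<Rightarrow> ('k, 'b, 'x) module_scheme \<Rightarrow> ('k, 'a, 'y) module_scheme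
    \<Rightarrow> ('b \<Rightarrow> 'a) set" where
  "algebra_hom K B A = {\<phi> \<in> ring_hom B A.
     \<forall>c\<in>carrier K. \<forall>x\<in>carrier B. \<phi> (c \<odot>\<^bsub>B\<^esub> x) = c \<odot>\<^bsub>A\<^esub> \<phi> x}"

text \<open>The groupoid algebra of a finite groupoid: formal linear combinations of morphisms, given by
  their coefficient functions (extended by zero outside \<^term>\<open>mor G\<close>).  The multiplication is the
  bilinear extension of the product on basis elements, see \<open>basis_elt_mult\<close> below.\<close>

definition groupoid_algebra ::
  "('k, 'm) ring_scheme \<Rightarrow> ('g, 'x) groupoid_scheme \<Rightarrow> ('k, 'g \<Rightarrow> 'k) module" where
  "groupoid_algebra K G =
    \<lparr> carrier = {f. (\<forall>x\<in>mor G. f x \<in> carrier K) \<and> (\<forall>x. x \<notin> mor G \<longrightarrow> f x = \<zero>\<^bsub>K\<^esub>)},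
      mult = (\<lambda>f f' x. \<Oplus>\<^bsub>K\<^esub>p\<in>{(y, z). y \<in> mor G \<and> z \<in> mor G \<and> src G y = trg G z \<and> y \<cdot>\<^bsub>G\<^esub> z = x}.
                f (fst p) \<otimes>\<^bsub>K\<^esub> f' (snd p)),
      one = (\<lambda>x. if x \<in> objs G then \<one>\<^bsub>K\<^esub> else \<zero>\<^bsub>K\<^esub>),
      zero = (\<lambda>x. \<zero>\<^bsub>K\<^esub>),
      add = (\<lambda>f f' x. f x \<oplus>\<^bsub>K\<^esub> f' x),
      smult = (\<lambda>c f x. c \<otimes>\<^bsub>K\<^esub> f x) \<rparr>"

definition basis_elt :: "('k, 'm) ring_scheme \<Rightarrow> 'g \<Rightarrow> ('g \<Rightarrow> 'k)" where
  "basis_elt K x = (\<lambda>y. if y = x then \<one>\<^bsub>K\<^esub> else \<zero>\<^bsub>K\<^esub>)"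

lemma basis_elt_mult:
  assumes "ring K" "finite (mor G)" "x \<in> mor G" "y \<in> mor G"
  shows "basis_elt K x \<otimes>\<^bsub>groupoid_algebra K G\<^esub> basis_elt K y =
    (if src G x = trg G y then basis_elt K (x \<cdot>\<^bsub>G\<^esub> y) else \<zero>\<^bsub>groupoid_algebra K G\<^esub>)"
proof
  interpret K: ring K by fact
  fix w
  let ?P = "{(y, z). y \<in> mor G \<and> z \<in> mor G \<and> src G y = trg G z \<and> y \<cdot>\<^bsub>G\<^esub> z = w}"
  have fin: "finite ?P"
    by (rule finite_subset[of _ "mor G \<times> mor G"]) (use assms in auto)
  have "(basis_elt K x \<otimes>\<^bsub>groupoid_algebra K G\<^esub> basis_elt K y) w =
      (\<Oplus>\<^bsub>K\<^esub>p\<in>?P. if (x, y) = p then \<one>\<^bsub>K\<^esub> else \<zero>\<^bsub>K\<^esub>)"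
    by (simp add: groupoid_algebra_def, rule K.finsum_cong) (auto simp: basis_elt_def simp_implies_def)
  also have "\<dots> = (if (x, y) \<in> ?P then \<one>\<^bsub>K\<^esub> else \<zero>\<^bsub>K\<^esub>)"
  proof (cases "(x, y) \<in> ?P")
    case True
    then show ?thesis using K.finsum_singleton[OF True fin, of "\<lambda>_. \<one>\<^bsub>K\<^esub>"] by simp
  next
    case False
    then have "(\<Oplus>\<^bsub>K\<^esub>p\<in>?P. if (x, y) = p then \<one>\<^bsub>K\<^esub> else \<zero>\<^bsub>K\<^esub>) = (\<Oplus>\<^bsub>K\<^esub>p\<in>?P. \<zero>\<^bsub>K\<^esub>)"
      by (intro K.finsum_cong) (auto simp: simp_implies_def)
    then show ?thesis using False by (simp only: K.finsum_zero if_False)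
  qed
  finally show "(basis_elt K x \<otimes>\<^bsub>groupoid_algebra K G\<^esub> basis_elt K y) w =
    (if src G x = trg G y then basis_elt K (x \<cdot>\<^bsub>G\<^esub> y) else \<zero>\<^bsub>groupoid_algebra K G\<^esub>) w"
    using assms by (auto simp: basis_elt_def groupoid_algebra_def)
qed


section \<open>Partial representations\<close>

definition partial_groupoid_rep ::
  "('g, 'x) groupoid_scheme \<Rightarrow> ('a, 'm) ring_scheme \<Rightarrow> ('g \<Rightarrow> 'a) \<Rightarrow> bool" where
  "partial_groupoid_rep G A \<pi> \<longleftrightarrow>
     \<pi> \<in> mor G \<rightarrow> carrier A \<and>
     (\<forall>g\<in>mor G. \<forall>h\<in>mor G. src G g = trg G h \<longrightarrow>
        \<pi> g \<otimes>\<^bsub>A\<^esub> \<pi> h \<otimes>\<^bsub>A\<^esub> \<pi> (ginv G h) = \<pi> (g \<cdot>\<^bsub>G\<^esub> h) \<otimes>\<^bsub>A\<^esub> \<pi> (ginv G h)) \<and>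
     (\<forall>g\<in>mor G. \<forall>h\<in>mor G. src G g = trg G h \<longrightarrow>
        \<pi> (ginv G g) \<otimes>\<^bsub>A\<^esub> \<pi> g \<otimes>\<^bsub>A\<^esub> \<pi> h = \<pi> (ginv G g) \<otimes>\<^bsub>A\<^esub> \<pi> (g \<cdot>\<^bsub>G\<^esub> h)) \<and>
     (\<forall>g\<in>mor G. \<pi> g \<otimes>\<^bsub>A\<^esub> \<pi> (ginv G g) \<otimes>\<^bsub>A\<^esub> \<pi> g = \<pi> g) \<and>
     (\<Oplus>\<^bsub>A\<^esub>e\<in>objs G. \<pi> e) = \<one>\<^bsub>A\<^esub> \<and>
     (\<forall>e\<in>objs G. \<forall>f\<in>objs G. e \<noteq> f \<longrightarrow> \<pi> e \<otimes>\<^bsub>A\<^esub> \<pi> f = \<zero>\<^bsub>A\<^esub>)"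

abbreviation br_algebra ::
  "('k, 'm) ring_scheme \<Rightarrow> ('g, 'x) groupoid_scheme \<Rightarrow> ('k, 'g set \<times> 'g \<Rightarrow> 'k) module" where
  "br_algebra K G \<equiv> groupoid_algebra K (birget_rhodes G)"

definition br_lambda ::
  "('k, 'm) ring_scheme \<Rightarrow> ('g, 'x) groupoid_scheme \<Rightarrow> 'g \<Rightarrow> ('g set \<times> 'g \<Rightarrow> 'k)" where
  "br_lambda K G g =
     (\<Oplus>\<^bsub>br_algebra K G\<^esub>
        A\<in>{A. ginv G g \<in> A \<and> (A, g) \<in> mor (birget_rhodes G)}. basis_elt K (A, g))"

end

theory Submission
  imports Defs
begin

text \<open>
  Homomorphisms out of a groupoid algebra \<open>KH\<close> amount to ring-valued representations of the
  groupoid \<open>H\<close>: maps \<open>\<rho>\<close> that turn composable pairs into products and other pairs into \<open>0\<close>, and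
  whose values on the objects add up to \<open>1\<close>. For \<open>H\<close> the expansion of \<open>G\<close> this removes the scalars
  from the problem: composing a homomorphism with \<open>br_lambda\<close> becomes the operation that sends
  \<open>\<rho>\<close> to \<open>\<pi> g = (\<Sum>A. \<rho> (A, g))\<close>, and what remains to be shown, in any unital ring, is that this
  operation is a bijection from representations of the expansion to partial representations of
  \<open>G\<close>.

  The operation lands in partial representations because the elements \<open>\<pi> g\<close> act on the values of
  \<open>\<rho>\<close> by left translation: \<open>\<pi> g \<cdot> \<rho> (B, k)\<close> is \<open>\<rho> (B, g k)\<close> if \<open>g k\<close> is defined and its inverse
  lies in \<open>B\<close>, and \<open>0\<close> otherwise (\<open>pi_act\<close>). Since the unit is the sum of the \<open>\<rho> (B, e)\<close>, an
  equation between ring elements may be tested by multiplication with these, and there all axioms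
  are visible.

  For the inverse, let \<open>\<pi>\<close> be a partial representation. The elements \<open>\<epsilon> a = \<pi> a \<cdot> \<pi> (a\<inverse>)\<close> are
  commuting idempotents, and \<open>\<pi> g \<cdot> \<epsilon> h = \<epsilon> (g h) \<cdot> \<pi> g\<close>. Finitely many commuting idempotents have
  a common eigendecomposition of \<open>1\<close>: a family of orthogonal idempotents \<open>P A\<close>, indexed by all
  sets \<open>A\<close> of morphisms and with sum \<open>1\<close>, such that \<open>\<epsilon> a\<close> acts on \<open>P A\<close> as \<open>1\<close> if \<open>a \<in> A\<close> and as
  \<open>0\<close> otherwise. Only those \<open>A\<close> that occur as objects of the expansion give a nonzero \<open>P A\<close>
  (\<open>atom_nonzero\<close>). The representation of the expansion is \<open>\<rho> (A, g) = \<pi> g \<cdot> P A\<close>; it is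
  multiplicative because \<open>\<pi> h \<cdot> P B = P (h B) \<cdot> \<pi> h\<close> (\<open>pi_atom\<close>).

  This \<open>\<rho>\<close> is the only possibility: \<open>\<rho> (A, g) = \<pi> g \<cdot> \<rho> (A, d g)\<close>, and for any \<open>\<rho>\<close> that
  induces \<open>\<pi>\<close> the \<open>\<rho> (A, e)\<close> are again a common eigendecomposition for the \<open>\<epsilon> a\<close>, hence determined
  by \<open>\<pi>\<close> (\<open>rep_eq_of_partial_eq\<close>). Both the intertwining relation and this uniqueness come from one
  remark: if \<open>(\<Sum>j. P j) = 1\<close> and \<open>P j \<cdot> x = 0\<close> for all \<open>j\<close> but \<open>i\<close>, then \<open>P i \<cdot> x = x\<close>.
\<close>

section \<open>Finite sums and decompositions of the unit\<close>

lemma (in abelian_monoid) finsum_eq_single: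
  assumes "finite I" "i \<in> I" "f i \<in> carrier G" "\<And>j. \<lbrakk>j \<in> I; j \<noteq> i\<rbrakk> \<Longrightarrow> f j = \<zero>"
  shows "(\<Oplus>j\<in>I. f j) = f i"
proof -
  have "f j \<in> carrier G" if "j \<in> I" for j
    using assms(3) assms(4)[OF that] by (cases "j = i") auto
  then have "(\<Oplus>j\<in>I. f j) = (\<Oplus>j\<in>{i}. f j)"
    using assms by (intro add.finprod_mono_neutral_cong_right) auto
  then show ?thesis using assms(3) by simp
qed

lemma (in abelian_monoid) finsum_fibres:
  assumes "finite S" "finite T" "h \<in> S \<rightarrow> T" "F \<in> S \<rightarrow> carrier G"
  shows "(\<Oplus>x\<in>T. \<Oplus>p\<in>{p \<in> S. h p = x}. F p) = (\<Oplus>p\<in>S. F p)"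
proof -
  have "S = (\<Union>x\<in>T. {p \<in> S. h p = x})" using assms(3) by auto
  then have "(\<Oplus>p\<in>S. F p) = (\<Oplus>p\<in>(\<Union>x\<in>T. {p \<in> S. h p = x}). F p)" by simp
  also have "\<dots> = (\<Oplus>x\<in>T. \<Oplus>p\<in>{p \<in> S. h p = x}. F p)"
    using assms by (intro add.finprod_UN_disjoint) (auto simp: pairwise_def disjnt_def)
  finally show ?thesis by simp
qed

lemma (in abelian_monoid) finsum_Times:
  assumes "finite S" "finite T" "\<And>x y. \<lbrakk>x \<in> S; y \<in> T\<rbrakk> \<Longrightarrow> F (x, y) \<in> carrier G"
  shows "(\<Oplus>x\<in>S. \<Oplus>y\<in>T. F (x, y)) = (\<Oplus>p\<in>S \<times> T. F p)"
proof -
  have "(\<Oplus>y\<in>T. F (x, y)) = (\<Oplus>p\<in>{p \<in> S \<times> T. fst p = x}. F p)" if "x \<in> S" for x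
  proof -
    have "{p \<in> S \<times> T. fst p = x} = Pair x ` T" using that by auto
    moreover have "F \<in> Pair x ` T \<rightarrow> carrier G" using assms(3) that by auto
    ultimately show ?thesis
      using finsum_reindex[of F "Pair x" T] by (simp add: inj_on_def)
  qed
  then have "(\<Oplus>x\<in>S. \<Oplus>y\<in>T. F (x, y)) = (\<Oplus>x\<in>S. \<Oplus>p\<in>{p \<in> S \<times> T. fst p = x}. F p)"
    using assms by (intro finsum_cong') (auto intro!: finsum_closed)
  also have "\<dots> = (\<Oplus>p\<in>S \<times> T. F p)"
    using assms by (intro finsum_fibres) auto
  finally show ?thesis .
qed

lemma (in ring) one_sum_absorb_left:
  assumes "finite I" "P \<in> I \<rightarrow> carrier R" "(\<Oplus>j\<in>I. P j) = \<one>" "x \<in> carrier R" "i \<in> I"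
    and "\<And>j. \<lbrakk>j \<in> I; j \<noteq> i\<rbrakk> \<Longrightarrow> P j \<otimes> x = \<zero>"
  shows "P i \<otimes> x = x"
proof -
  have "x = (\<Oplus>j\<in>I. P j) \<otimes> x" using assms by simp
  also have "\<dots> = (\<Oplus>j\<in>I. P j \<otimes> x)" using assms by (intro finsum_ldistr) auto
  also have "\<dots> = P i \<otimes> x" using assms by (intro finsum_eq_single) auto
  finally show ?thesis by simp
qed

lemma (in ring) one_sum_absorb_right:
  assumes "finite I" "P \<in> I \<rightarrow> carrier R" "(\<Oplus>j\<in>I. P j) = \<one>" "x \<in> carrier R" "i \<in> I"
    and "\<And>j. \<lbrakk>j \<in> I; j \<noteq> i\<rbrakk> \<Longrightarrow> x \<otimes> P j = \<zero>"
  shows "x \<otimes> P i = x"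
proof -
  have "x = x \<otimes> (\<Oplus>j\<in>I. P j)" using assms by simp
  also have "\<dots> = (\<Oplus>j\<in>I. x \<otimes> P j)" using assms by (intro finsum_rdistr) auto
  also have "\<dots> = x \<otimes> P i" using assms by (intro finsum_eq_single) auto
  finally show ?thesis by simp
qed

lemma (in ring) one_sum_ext:
  assumes "finite I" "P \<in> I \<rightarrow> carrier R" "(\<Oplus>i\<in>I. P i) = \<one>" "u \<in> carrier R" "v \<in> carrier R"
    and "\<And>i. i \<in> I \<Longrightarrow> u \<otimes> P i = v \<otimes> P i"
  shows "u = v"
proof -
  have "u = u \<otimes> (\<Oplus>i\<in>I. P i)" using assms by simp
  also have "\<dots> = (\<Oplus>i\<in>I. u \<otimes> P i)" using assms by (intro finsum_rdistr) auto
  also have "\<dots> = (\<Oplus>i\<in>I. v \<otimes> P i)" using assms by (intro finsum_cong') auto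
  also have "\<dots> = v \<otimes> (\<Oplus>i\<in>I. P i)" using assms by (intro finsum_rdistr[symmetric]) auto
  finally show ?thesis using assms by simp
qed

text \<open>The witness is \<open>P A = (\<Prod>a\<in>A. \<epsilon> a) \<cdot> (\<Prod>a\<in>S - A. 1 - \<epsilon> a)\<close>, the minimal idempotents of
  the Boolean algebra generated by the \<open>\<epsilon> a\<close>; their sum is the expansion of
  \<open>(\<Prod>a\<in>S. \<epsilon> a + (1 - \<epsilon> a))\<close>. The product is built up one factor at a time, since the ring
  need not be commutative. The last conjunct says that \<open>P A\<close> lies in the bicommutant of the
  \<open>\<epsilon> a\<close>. It turns the left eigenvalue equations into right ones.\<close>

lemma (in ring) commuting_idempotents_atoms:
  assumes "finite S" "\<epsilon> \<in> S \<rightarrow> carrier R"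
    and "\<And>a. a \<in> S \<Longrightarrow> \<epsilon> a \<otimes> \<epsilon> a = \<epsilon> a"
    and "\<And>a b. \<lbrakk>a \<in> S; b \<in> S\<rbrakk> \<Longrightarrow> \<epsilon> a \<otimes> \<epsilon> b = \<epsilon> b \<otimes> \<epsilon> a"
  shows "\<exists>P. P \<in> Pow S \<rightarrow> carrier R \<and> (\<Oplus>A\<in>Pow S. P A) = \<one> \<and>
    (\<forall>A\<in>Pow S. \<forall>a\<in>S. \<epsilon> a \<otimes> P A = (if a \<in> A then P A else \<zero>)) \<and>
    (\<forall>y\<in>carrier R. (\<forall>a\<in>S. y \<otimes> \<epsilon> a = \<epsilon> a \<otimes> y) \<longrightarrow> (\<forall>A\<in>Pow S. y \<otimes> P A = P A \<otimes> y))"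
  using assms
proof (induction S rule: finite_induct)
  case empty
  then show ?case by (intro exI[of _ "\<lambda>_. \<one>"]) auto
next
  case (insert x S)
  from insert.IH insert.prems obtain P where P: "P \<in> Pow S \<rightarrow> carrier R" "(\<Oplus>A\<in>Pow S. P A) = \<one>"
    and eig: "\<And>A a. \<lbrakk>A \<subseteq> S; a \<in> S\<rbrakk> \<Longrightarrow> \<epsilon> a \<otimes> P A = (if a \<in> A then P A else \<zero>)"
    and comm: "\<And>y A. \<lbrakk>y \<in> carrier R; \<forall>a\<in>S. y \<otimes> \<epsilon> a = \<epsilon> a \<otimes> y; A \<subseteq> S\<rbrakk> \<Longrightarrow> y \<otimes> P A = P A \<otimes> y"
    by (auto simp: Pi_def)
  have e: "\<epsilon> a \<in> carrier R" if "a \<in> insert x S" for a using insert.prems that by auto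
  have ex: "\<epsilon> x \<in> carrier R" using e by simp
  have PC: "P A \<in> carrier R" if "A \<subseteq> S" for A using P that by auto
  define q where "q A = (if x \<in> A then \<epsilon> x else \<one> \<ominus> \<epsilon> x)" for A
  have q: "q A \<in> carrier R" for A using ex by (simp add: q_def)
  define Q where "Q A = q A \<otimes> P (A - {x})" for A
  have QC: "Q A \<in> carrier R" if "A \<subseteq> insert x S" for A
    unfolding Q_def using that q by (intro m_closed PC) auto
  have qcomm: "y \<otimes> q A = q A \<otimes> y" if "y \<in> carrier R" "y \<otimes> \<epsilon> x = \<epsilon> x \<otimes> y" for y A
    using that ex by (auto simp: q_def a_minus_def r_distr l_distr r_minus l_minus)
  have one: "(\<Oplus>A\<in>Pow (insert x S). Q A) = \<one>"
  proof -
    have inj: "inj_on (insert x) (Pow S)" using \<open>x \<notin> S\<close> by (auto simp: inj_on_def)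
    have "(\<Oplus>A\<in>Pow (insert x S). Q A) = (\<Oplus>A\<in>Pow S. Q A) \<oplus> (\<Oplus>A\<in>insert x ` Pow S. Q A)"
      unfolding Pow_insert using \<open>x \<notin> S\<close> \<open>finite S\<close>
      by (intro finsum_Un_disjoint) (auto intro!: QC)
    also have "(\<Oplus>A\<in>insert x ` Pow S. Q A) = (\<Oplus>A\<in>Pow S. Q (insert x A))"
      by (rule finsum_reindex) (use inj in \<open>auto intro!: QC\<close>)
    also have "(\<Oplus>A\<in>Pow S. Q A) = (\<Oplus>A\<in>Pow S. (\<one> \<ominus> \<epsilon> x) \<otimes> P A)"
      using \<open>x \<notin> S\<close> PC ex by (intro finsum_cong') (auto simp: Q_def q_def subset_iff)
    also have "(\<Oplus>A\<in>Pow S. Q (insert x A)) = (\<Oplus>A\<in>Pow S. \<epsilon> x \<otimes> P A)"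
    proof (intro finsum_cong' refl)
      fix A assume "A \<in> Pow S"
      then have "insert x A - {x} = A" using \<open>x \<notin> S\<close> by auto
      then show "Q (insert x A) = \<epsilon> x \<otimes> P A" by (simp add: Q_def q_def)
    qed (use PC ex in auto)
    also have "(\<Oplus>A\<in>Pow S. (\<one> \<ominus> \<epsilon> x) \<otimes> P A) = \<one> \<ominus> \<epsilon> x"
      using finsum_rdistr[of "Pow S" "\<one> \<ominus> \<epsilon> x" P] P ex \<open>finite S\<close> by simp
    also have "(\<Oplus>A\<in>Pow S. \<epsilon> x \<otimes> P A) = \<epsilon> x"
      using finsum_rdistr[of "Pow S" "\<epsilon> x" P] P ex \<open>finite S\<close> by simp
    finally show ?thesis using ex by (simp add: a_minus_def a_assoc l_neg)
  qed
  have eigQ: "\<epsilon> a \<otimes> Q A = (if a \<in> A then Q A else \<zero>)" if "A \<subseteq> insert x S" "a \<in> insert x S" for A a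
  proof (cases "a = x")
    case True
    have "\<epsilon> x \<otimes> q A = (if x \<in> A then q A else \<zero>)"
      using insert.prems(2)[of x] ex by (simp add: q_def a_minus_def r_distr r_minus r_neg)
    moreover have "P (A - {x}) \<in> carrier R" using that by (intro PC) auto
    ultimately show ?thesis using True ex q by (auto simp: Q_def m_assoc[symmetric])
  next
    case False
    have p: "P (A - {x}) \<in> carrier R" using that by (intro PC) auto
    have "\<epsilon> a \<otimes> q A = q A \<otimes> \<epsilon> a" using that by (intro qcomm e insert.prems) auto
    moreover have "\<epsilon> a \<otimes> P (A - {x}) = (if a \<in> A then P (A - {x}) else \<zero>)"
      using eig[of "A - {x}" a] that False by (auto simp: Diff_subset_conv)
    moreover have "\<epsilon> a \<otimes> (q A \<otimes> P (A - {x})) = q A \<otimes> (\<epsilon> a \<otimes> P (A - {x}))"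
      using calculation(1) e[OF that(2)] p q[of A] by (metis m_assoc)
    ultimately show ?thesis unfolding Q_def using p q[of A] by simp
  qed
  have commQ: "y \<otimes> Q A = Q A \<otimes> y"
    if "y \<in> carrier R" "\<forall>a\<in>insert x S. y \<otimes> \<epsilon> a = \<epsilon> a \<otimes> y" "A \<subseteq> insert x S" for y A
  proof -
    have p: "P (A - {x}) \<in> carrier R" using that by (intro PC) auto
    have "y \<otimes> P (A - {x}) = P (A - {x}) \<otimes> y" using that by (intro comm) auto
    moreover have "y \<otimes> q A = q A \<otimes> y" using that by (intro qcomm) auto
    ultimately show ?thesis unfolding Q_def using p q[of A] that(1) by (metis m_assoc)
  qed
  show ?case using one eigQ commQ QC by (intro exI[of _ Q]) auto
qed


section \<open>The Birget-Rhodes expansion\<close>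

context groupoid
begin

lemma cmp_cancel_left:
  assumes "g \<in> mor G" "h \<in> mor G" "src G g = trg G h"
  shows "ginv G g \<cdot> (g \<cdot> h) = h"
  using assms ginv[OF assms(1)] cmp_assoc[of "ginv G g" g h] trg_cmp_id[of h] by simp

lemma cmp_cancel_left':
  assumes "g \<in> mor G" "h \<in> mor G" "trg G g = trg G h"
  shows "g \<cdot> (ginv G g \<cdot> h) = h"
  using assms ginv[OF assms(1)] cmp_assoc[of g "ginv G g" h] trg_cmp_id[of h] by simp

lemma cmp_cancel_right:
  assumes "g \<in> mor G" "h \<in> mor G" "src G g = trg G h"
  shows "g \<cdot> h \<cdot> ginv G h = g"
  using assms ginv[OF assms(2)] cmp_assoc[of g h "ginv G h"] cmp_src[of g] by simp

lemma ginv_ginv: "g \<in> mor G \<Longrightarrow> ginv G (ginv G g) = g"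
  using ginv[of g] by (intro ginv_eqI) auto

lemma ginv_cmp:
  assumes "g \<in> mor G" "h \<in> mor G" "src G g = trg G h"
  shows "ginv G (g \<cdot> h) = ginv G h \<cdot> ginv G g"
proof (rule ginv_eqI)
  show "ginv G h \<cdot> ginv G g \<cdot> (g \<cdot> h) = src G (g \<cdot> h)"
    using assms ginv[OF assms(1)] ginv[OF assms(2)] cmp_cancel_left[OF assms]
    by (simp add: cmp_assoc cmp_closed src_cmp trg_cmp)
qed (use assms ginv[OF assms(1)] ginv[OF assms(2)] in
    \<open>simp_all add: cmp_closed src_cmp trg_cmp\<close>)

lemma objs_mor: "e \<in> objs G \<Longrightarrow> e \<in> mor G"
  and objs_src: "e \<in> objs G \<Longrightarrow> src G e = e"
  and objs_trg: "e \<in> objs G \<Longrightarrow> trg G e = e"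
  and objs_ginv: "e \<in> objs G \<Longrightarrow> ginv G e = e"
  using trg_src[of e] ginv_src[of e] by (auto simp: objs_def)

lemma src_objs: "g \<in> mor G \<Longrightarrow> src G g \<in> objs G"
  and trg_objs: "g \<in> mor G \<Longrightarrow> trg G g \<in> objs G"
  by (simp_all add: objs_def src_closed src_src trg_closed src_trg)

lemma mor_birget_rhodes:
  "(A, g) \<in> mor (birget_rhodes G) \<longleftrightarrow>
    g \<in> mor G \<and> A \<subseteq> star_at G g \<and> src G g \<in> A \<and> ginv G g \<in> A"
  by (simp add: birget_rhodes_def)

lemma objs_birget_rhodes:
  "(A, e) \<in> objs (birget_rhodes G) \<longleftrightarrow> e \<in> objs G \<and> e \<in> A \<and> A \<subseteq> star_at G e"
  by (auto simp: objs_def birget_rhodes_def ginv_src src_closed) (metis ginv_src)+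

end

lemma birget_rhodes_simps [simp]:
  "src (birget_rhodes G) (A, g) = (A, src G g)"
  "trg (birget_rhodes G) (A, g) = ((\<lambda>a. g \<cdot>\<^bsub>G\<^esub> a) ` A, trg G g)"
  "(A, g) \<cdot>\<^bsub>birget_rhodes G\<^esub> (B, h) = (B, g \<cdot>\<^bsub>G\<^esub> h)"
  by (simp_all add: birget_rhodes_def)

lemma (in groupoid) finite_mor_birget_rhodes:
  "finite (mor G) \<Longrightarrow> finite (mor (birget_rhodes G))"
  by (rule finite_subset[of _ "Pow (mor G) \<times> mor G"]) (auto simp: birget_rhodes_def star_at_def)


section \<open>Representations of groupoids\<close>

text \<open>These are exactly the conditions under which the linear extension of \<open>\<rho>\<close> to the groupoid algebra
  preserves products and the unit.\<close>

definition groupoid_rep :: "('h, 'x) groupoid_scheme \<Rightarrow> ('a, 'm) ring_scheme \<Rightarrow> ('h \<Rightarrow> 'a) \<Rightarrow> bool"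
  where "groupoid_rep H R \<rho> \<longleftrightarrow>
     \<rho> \<in> mor H \<rightarrow> carrier R \<and>
     (\<forall>x\<in>mor H. \<forall>y\<in>mor H. \<rho> x \<otimes>\<^bsub>R\<^esub> \<rho> y =
        (if src H x = trg H y then \<rho> (x \<cdot>\<^bsub>H\<^esub> y) else \<zero>\<^bsub>R\<^esub>)) \<and>
     (\<Oplus>\<^bsub>R\<^esub>x\<in>objs H. \<rho> x) = \<one>\<^bsub>R\<^esub>"

lemma (in groupoid) objs_cmp:
  assumes "e \<in> objs G" "f \<in> objs G"
  shows "src G e = trg G f \<longleftrightarrow> e = f" "e \<cdot> e = e"
  using assms cmp_src[of e] by (auto simp: objs_mor objs_src objs_trg)


section \<open>Homomorphisms from groupoid algebras\<close>

locale finite_groupoid_algebra =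
  fixes H :: "('h, 'x) groupoid_scheme" and K :: "('k, 'm) ring_scheme"
    and A :: "('k, 'a, 'y) module_scheme"
  assumes groupoid_H: "groupoid H" and finite_H: "finite (mor H)"
    and unital_algebra_A: "unital_algebra K A"
begin

sublocale groupoid H by (rule groupoid_H)
sublocale K: cring K
  using unital_algebra_A by (simp add: unital_algebra_def module_def)
sublocale A: ring A
  using unital_algebra_A by (simp add: unital_algebra_def)
sublocale M: module K A
  using unital_algebra_A by (simp add: unital_algebra_def)

abbreviation KH where "KH \<equiv> groupoid_algebra K H"

lemma smult_mult_smult:
  assumes "a \<in> carrier K" "b \<in> carrier K" "x \<in> carrier A" "y \<in> carrier A"
  shows "(a \<odot>\<^bsub>A\<^esub> x) \<otimes>\<^bsub>A\<^esub> (b \<odot>\<^bsub>A\<^esub> y) = (a \<otimes>\<^bsub>K\<^esub> b) \<odot>\<^bsub>A\<^esub> (x \<otimes>\<^bsub>A\<^esub> y)"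
  using assms unital_algebra.smult_mult_left[OF unital_algebra_A, of a x "b \<odot>\<^bsub>A\<^esub> y"]
    unital_algebra.smult_mult_right[OF unital_algebra_A, of b x y]
  by (simp add: M.smult_assoc1)

text \<open>The counterpart of \<open>finsum_smult_ldistr\<close> for a sum of scalars.\<close>

lemma smult_finsum:
  assumes "finite S" "x \<in> carrier A" "f \<in> S \<rightarrow> carrier K"
  shows "(\<Oplus>\<^bsub>K\<^esub>i\<in>S. f i) \<odot>\<^bsub>A\<^esub> x = (\<Oplus>\<^bsub>A\<^esub>i\<in>S. f i \<odot>\<^bsub>A\<^esub> x)"
  using assms
proof (induction S rule: finite_induct)
  case (insert i S)
  then have "f \<in> S \<rightarrow> carrier K" "(\<lambda>i. f i \<odot>\<^bsub>A\<^esub> x) \<in> S \<rightarrow> carrier A" by auto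
  then show ?case
    using insert by (simp add: M.smult_l_distr)
qed simp

lemma carrier_KH: "f \<in> carrier KH \<longleftrightarrow>
    (\<forall>x. f x \<in> carrier K) \<and> (\<forall>x. x \<notin> mor H \<longrightarrow> f x = \<zero>\<^bsub>K\<^esub>)"
  by (simp add: groupoid_algebra_def) (metis K.zero_closed)

lemma KH_simps:
  "\<zero>\<^bsub>KH\<^esub> = (\<lambda>x. \<zero>\<^bsub>K\<^esub>)" "f \<oplus>\<^bsub>KH\<^esub> f' = (\<lambda>x. f x \<oplus>\<^bsub>K\<^esub> f' x)"
  "c \<odot>\<^bsub>KH\<^esub> f = (\<lambda>x. c \<otimes>\<^bsub>K\<^esub> f x)"
  "\<one>\<^bsub>KH\<^esub> = (\<lambda>x. if x \<in> objs H then \<one>\<^bsub>K\<^esub> else \<zero>\<^bsub>K\<^esub>)"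
  by (simp_all add: groupoid_algebra_def)

lemma smult_KH_closed: "\<lbrakk>c \<in> carrier K; f \<in> carrier KH\<rbrakk> \<Longrightarrow> c \<odot>\<^bsub>KH\<^esub> f \<in> carrier KH"
  by (simp add: carrier_KH KH_simps)

lemma abelian_group_KH: "abelian_group KH"
proof (rule abelian_groupI)
  fix f assume f: "f \<in> carrier KH"
  then show "\<exists>f'\<in>carrier KH. f' \<oplus>\<^bsub>KH\<^esub> f = \<zero>\<^bsub>KH\<^esub>"
    by (intro bexI[of _ "\<lambda>x. \<ominus>\<^bsub>K\<^esub> f x"]) (simp_all add: carrier_KH KH_simps K.l_neg)
qed (auto simp: carrier_KH KH_simps K.a_ac)

sublocale KH: abelian_group KH by (rule abelian_group_KH)

lemma finsum_KH_apply:
  assumes "F \<in> S \<rightarrow> carrier KH"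
  shows "(\<Oplus>\<^bsub>KH\<^esub>i\<in>S. F i) x = (\<Oplus>\<^bsub>K\<^esub>i\<in>S. F i x)"
  using assms
proof (induction S rule: infinite_finite_induct)
  case (insert i S)
  then have "F \<in> S \<rightarrow> carrier KH" "F i \<in> carrier KH" by auto
  moreover from this have "(\<lambda>i. F i x) \<in> S \<rightarrow> carrier K" "F i x \<in> carrier K"
    by (auto simp: carrier_KH Pi_def)
  ultimately show ?case using insert by (simp add: KH_simps(2))
qed (simp_all add: KH_simps(1))

lemma mult_KH_closed:
  assumes "f \<in> carrier KH" "f' \<in> carrier KH"
  shows "f \<otimes>\<^bsub>KH\<^esub> f' \<in> carrier KH"
  unfolding carrier_KH
proof (intro conjI allI impI)
  let ?P = "\<lambda>x. {(y, z). y \<in> mor H \<and> z \<in> mor H \<and> src H y = trg H z \<and> y \<cdot>\<^bsub>H\<^esub> z = x}"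
  have mult: "(f \<otimes>\<^bsub>KH\<^esub> f') x = (\<Oplus>\<^bsub>K\<^esub>p\<in>?P x. f (fst p) \<otimes>\<^bsub>K\<^esub> f' (snd p))" for x
    by (simp add: groupoid_algebra_def)
  show "(f \<otimes>\<^bsub>KH\<^esub> f') x \<in> carrier K" for x
    unfolding mult using assms by (intro K.finsum_closed) (auto simp: carrier_KH)
  show "(f \<otimes>\<^bsub>KH\<^esub> f') x = \<zero>\<^bsub>K\<^esub>" if "x \<notin> mor H" for x
  proof -
    have "?P x = {}" using that cmp_closed by auto
    then show ?thesis unfolding mult by (simp only: K.finsum_empty)
  qed
qed

text \<open>Being a homomorphism concerns only the values on the carrier, which is closed under the
  operations, so the extensional representative may be chosen.\<close>

lemma restrict_hom:
  assumes "\<phi> \<in> algebra_hom K KH A"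
  shows "restrict \<phi> (carrier KH) \<in> algebra_hom K KH A"
proof -
  have "\<one>\<^bsub>KH\<^esub> \<in> carrier KH" by (auto simp: carrier_KH KH_simps objs_mor)
  then show ?thesis
    using assms mult_KH_closed smult_KH_closed by (auto simp: algebra_hom_def ring_hom_def)
qed

lemma basis_closed: "x \<in> mor H \<Longrightarrow> basis_elt K x \<in> carrier KH"
  by (auto simp: carrier_KH basis_elt_def)

lemma KH_one: "\<one>\<^bsub>KH\<^esub> = (\<Oplus>\<^bsub>KH\<^esub>x\<in>objs H. basis_elt K x)"
proof
  fix y
  have fin: "finite (objs H)" using finite_H by (simp add: objs_def)
  have "(\<Oplus>\<^bsub>KH\<^esub>x\<in>objs H. basis_elt K x) y = (\<Oplus>\<^bsub>K\<^esub>x\<in>objs H. basis_elt K x y)"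
    by (rule finsum_KH_apply) (auto simp: basis_closed objs_def)
  also have "\<dots> = \<one>\<^bsub>KH\<^esub> y"
  proof (cases "y \<in> objs H")
    case True
    then show ?thesis
      using K.finsum_eq_single[OF fin, of y "\<lambda>x. basis_elt K x y"]
      by (simp add: basis_elt_def KH_simps)
  next
    case False
    then show ?thesis by (auto simp: basis_elt_def KH_simps intro!: K.add.finprod_one_eqI)
  qed
  finally show "\<one>\<^bsub>KH\<^esub> y = (\<Oplus>\<^bsub>KH\<^esub>x\<in>objs H. basis_elt K x) y" by simp
qed

lemma basis_expansion:
  assumes f: "f \<in> carrier KH"
  shows "f = (\<Oplus>\<^bsub>KH\<^esub>x\<in>mor H. f x \<odot>\<^bsub>KH\<^esub> basis_elt K x)"
proof
  fix y
  have fC: "f x \<in> carrier K" for x using f by (simp add: carrier_KH)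
  have "(\<Oplus>\<^bsub>KH\<^esub>x\<in>mor H. f x \<odot>\<^bsub>KH\<^esub> basis_elt K x) y
      = (\<Oplus>\<^bsub>K\<^esub>x\<in>mor H. (f x \<odot>\<^bsub>KH\<^esub> basis_elt K x) y)"
    using fC by (intro finsum_KH_apply) (auto simp: basis_closed smult_KH_closed)
  also have "\<dots> = f y"
  proof (cases "y \<in> mor H")
    case True
    then show ?thesis
      using K.finsum_eq_single[OF finite_H True, of "\<lambda>x. (f x \<odot>\<^bsub>KH\<^esub> basis_elt K x) y"] fC
      by (simp add: basis_elt_def KH_simps)
  next
    case False
    then show ?thesis
      using f fC by (auto simp: basis_elt_def KH_simps carrier_KH intro!: K.add.finprod_one_eqI)
  qed
  finally show "f y = (\<Oplus>\<^bsub>KH\<^esub>x\<in>mor H. f x \<odot>\<^bsub>KH\<^esub> basis_elt K x) y" by simp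
qed

lemma hom_finsum:
  assumes hom: "\<phi> \<in> algebra_hom K KH A" and F: "F \<in> S \<rightarrow> carrier KH"
  shows "\<phi> (\<Oplus>\<^bsub>KH\<^esub>i\<in>S. F i) = (\<Oplus>\<^bsub>A\<^esub>i\<in>S. \<phi> (F i))"
proof -
  have ring: "\<phi> \<in> ring_hom KH A" using hom by (simp add: algebra_hom_def)
  have zero: "\<phi> \<zero>\<^bsub>KH\<^esub> = \<zero>\<^bsub>A\<^esub>"
  proof -
    have "\<phi> (\<zero>\<^bsub>K\<^esub> \<odot>\<^bsub>KH\<^esub> \<zero>\<^bsub>KH\<^esub>) = \<zero>\<^bsub>K\<^esub> \<odot>\<^bsub>A\<^esub> \<phi> \<zero>\<^bsub>KH\<^esub>"
      using hom by (simp add: algebra_hom_def)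
    moreover have "\<zero>\<^bsub>K\<^esub> \<odot>\<^bsub>KH\<^esub> \<zero>\<^bsub>KH\<^esub> = \<zero>\<^bsub>KH\<^esub>" by (simp add: KH_simps)
    ultimately show ?thesis using ring_hom_memE(1)[OF ring] by simp
  qed
  show ?thesis using F
  proof (induction S rule: infinite_finite_induct)
    case (insert i S)
    then have "F \<in> S \<rightarrow> carrier KH" "F i \<in> carrier KH" by auto
    moreover from this have "(\<lambda>i. \<phi> (F i)) \<in> S \<rightarrow> carrier A" "\<phi> (F i) \<in> carrier A"
      using ring_hom_memE(1)[OF ring] by auto
    ultimately show ?case
      using insert ring_hom_memE(3)[OF ring] by simp
  qed (simp_all add: zero)
qed

lemma algebra_hom_expansion:
  assumes hom: "\<phi> \<in> algebra_hom K KH A" and f: "f \<in> carrier KH"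
  shows "\<phi> f = (\<Oplus>\<^bsub>A\<^esub>x\<in>mor H. f x \<odot>\<^bsub>A\<^esub> \<phi> (basis_elt K x))"
proof -
  have fC: "f x \<in> carrier K" for x using f by (simp add: carrier_KH)
  have C: "\<phi> (basis_elt K x) \<in> carrier A" if "x \<in> mor H" for x
    using hom basis_closed[OF that] by (auto simp: algebra_hom_def ring_hom_def)
  have "\<phi> f = \<phi> (\<Oplus>\<^bsub>KH\<^esub>x\<in>mor H. f x \<odot>\<^bsub>KH\<^esub> basis_elt K x)"
    using basis_expansion[OF f] by simp
  also have "\<dots> = (\<Oplus>\<^bsub>A\<^esub>x\<in>mor H. \<phi> (f x \<odot>\<^bsub>KH\<^esub> basis_elt K x))"
    using fC by (intro hom_finsum[OF hom]) (auto simp: basis_closed smult_KH_closed)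
  also have "\<dots> = (\<Oplus>\<^bsub>A\<^esub>x\<in>mor H. f x \<odot>\<^bsub>A\<^esub> \<phi> (basis_elt K x))"
    using hom fC basis_closed C by (intro A.finsum_cong') (auto simp: algebra_hom_def)
  finally show ?thesis .
qed

lemma groupoid_rep_of_hom:
  assumes hom: "\<phi> \<in> algebra_hom K KH A"
  shows "groupoid_rep H A (\<lambda>x. \<phi> (basis_elt K x))"
  unfolding groupoid_rep_def
proof (intro conjI ballI)
  have ring: "\<phi> \<in> ring_hom KH A" using hom by (simp add: algebra_hom_def)
  show "(\<lambda>x. \<phi> (basis_elt K x)) \<in> mor H \<rightarrow> carrier A"
    using ring_hom_memE(1)[OF ring] basis_closed by auto
  have zero: "\<phi> \<zero>\<^bsub>KH\<^esub> = \<zero>\<^bsub>A\<^esub>" using hom_finsum[OF hom, of _ "{}"] by simp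
  show "\<phi> (basis_elt K x) \<otimes>\<^bsub>A\<^esub> \<phi> (basis_elt K y) =
      (if src H x = trg H y then \<phi> (basis_elt K (x \<cdot>\<^bsub>H\<^esub> y)) else \<zero>\<^bsub>A\<^esub>)"
    if "x \<in> mor H" "y \<in> mor H" for x y
    using ring_hom_memE(2)[OF ring basis_closed[OF that(1)] basis_closed[OF that(2)]]
      basis_elt_mult[OF K.ring_axioms finite_H that] zero by (auto split: if_splits)
  show "(\<Oplus>\<^bsub>A\<^esub>x\<in>objs H. \<phi> (basis_elt K x)) = \<one>\<^bsub>A\<^esub>"
    using hom_finsum[OF hom, of "basis_elt K" "objs H"] KH_one ring_hom_memE(4)[OF ring]
    by (simp add: Pi_def basis_closed objs_mor)
qed

definition linear_ext where
  "linear_ext \<rho> f = (\<Oplus>\<^bsub>A\<^esub>x\<in>mor H. f x \<odot>\<^bsub>A\<^esub> \<rho> x)"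

lemma linear_ext_basis:
  assumes "\<rho> \<in> mor H \<rightarrow> carrier A" "x \<in> mor H"
  shows "linear_ext \<rho> (basis_elt K x) = \<rho> x"
proof -
  have "linear_ext \<rho> (basis_elt K x) = basis_elt K x x \<odot>\<^bsub>A\<^esub> \<rho> x"
    unfolding linear_ext_def using finite_H assms
    by (intro A.finsum_eq_single) (auto simp: basis_elt_def Pi_def)
  then show ?thesis using assms by (simp add: basis_elt_def Pi_def)
qed

text \<open>Both sides are sums of \<open>F (y, z) = f y f' z \<rho> y \<rho> z\<close>. On the left the pairs are restricted to
  composable ones and grouped by their product; on the right all pairs occur, and those that are
  not composable contribute \<open>0\<close>.\<close>

lemma linear_ext_mult:
  assumes rep: "groupoid_rep H A \<rho>" and f: "f \<in> carrier KH" and f': "f' \<in> carrier KH"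
  shows "linear_ext \<rho> (f \<otimes>\<^bsub>KH\<^esub> f') = linear_ext \<rho> f \<otimes>\<^bsub>A\<^esub> linear_ext \<rho> f'"
proof -
  have fC: "f x \<in> carrier K" "f' x \<in> carrier K" for x using f f' by (simp_all add: carrier_KH)
  have rC: "\<rho> x \<in> carrier A" if "x \<in> mor H" for x
    using rep that by (auto simp: groupoid_rep_def)
  have mult: "\<rho> x \<otimes>\<^bsub>A\<^esub> \<rho> y = (if src H x = trg H y then \<rho> (x \<cdot>\<^bsub>H\<^esub> y) else \<zero>\<^bsub>A\<^esub>)"
    if "x \<in> mor H" "y \<in> mor H" for x y
    using rep that by (auto simp: groupoid_rep_def)
  define C where "C = {(y, z). y \<in> mor H \<and> z \<in> mor H \<and> src H y = trg H z}"
  have C: "C \<subseteq> mor H \<times> mor H" by (auto simp: C_def)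
  then have finC: "finite C" by (rule finite_subset) (use finite_H in auto)
  define F where "F p = (f (fst p) \<otimes>\<^bsub>K\<^esub> f' (snd p)) \<odot>\<^bsub>A\<^esub> (\<rho> (fst p) \<otimes>\<^bsub>A\<^esub> \<rho> (snd p))" for p
  have FC: "F p \<in> carrier A" if "p \<in> mor H \<times> mor H" for p
    using that fC rC by (auto simp: F_def)
  let ?m = "\<lambda>p. fst p \<cdot>\<^bsub>H\<^esub> snd p"
  have "linear_ext \<rho> (f \<otimes>\<^bsub>KH\<^esub> f') = (\<Oplus>\<^bsub>A\<^esub>x\<in>mor H. \<Oplus>\<^bsub>A\<^esub>p\<in>{p \<in> C. ?m p = x}. F p)"
    unfolding linear_ext_def
  proof (intro A.finsum_cong' refl)
    fix x assume x: "x \<in> mor H"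
    let ?P = "{p \<in> C. ?m p = x}"
    have P: "{(y, z). y \<in> mor H \<and> z \<in> mor H \<and> src H y = trg H z \<and> y \<cdot>\<^bsub>H\<^esub> z = x} = ?P"
      by (auto simp: C_def)
    have "(f \<otimes>\<^bsub>KH\<^esub> f') x \<odot>\<^bsub>A\<^esub> \<rho> x
        = (\<Oplus>\<^bsub>K\<^esub>p\<in>?P. f (fst p) \<otimes>\<^bsub>K\<^esub> f' (snd p)) \<odot>\<^bsub>A\<^esub> \<rho> x"
      by (simp add: groupoid_algebra_def P)
    also have "\<dots> = (\<Oplus>\<^bsub>A\<^esub>p\<in>?P. (f (fst p) \<otimes>\<^bsub>K\<^esub> f' (snd p)) \<odot>\<^bsub>A\<^esub> \<rho> x)"
      using finC rC[OF x] fC by (intro smult_finsum) auto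
    also have "\<dots> = (\<Oplus>\<^bsub>A\<^esub>p\<in>?P. F p)"
      using FC C by (intro A.finsum_cong') (auto simp: F_def C_def mult)
    finally show "(f \<otimes>\<^bsub>KH\<^esub> f') x \<odot>\<^bsub>A\<^esub> \<rho> x = (\<Oplus>\<^bsub>A\<^esub>p\<in>?P. F p)" .
  qed (use FC C in \<open>auto intro!: A.finsum_closed\<close>)
  also have "\<dots> = (\<Oplus>\<^bsub>A\<^esub>p\<in>C. F p)"
    using finC finite_H FC C by (intro A.finsum_fibres) (auto simp: C_def cmp_closed)
  also have "\<dots> = (\<Oplus>\<^bsub>A\<^esub>p\<in>mor H \<times> mor H. F p)"
  proof (rule A.add.finprod_mono_neutral_cong_left)
    fix p assume "p \<in> mor H \<times> mor H - C"
    then obtain y z where "p = (y, z)" "y \<in> mor H" "z \<in> mor H" "src H y \<noteq> trg H z"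
      by (auto simp: C_def)
    then show "F p = \<zero>\<^bsub>A\<^esub>" using fC by (simp add: F_def mult)
  qed (use finite_H C FC in auto)
  also have "\<dots> = (\<Oplus>\<^bsub>A\<^esub>y\<in>mor H. \<Oplus>\<^bsub>A\<^esub>z\<in>mor H. F (y, z))"
    using finite_H FC by (intro A.finsum_Times[symmetric]) auto
  also have "\<dots> = (\<Oplus>\<^bsub>A\<^esub>y\<in>mor H. (f y \<odot>\<^bsub>A\<^esub> \<rho> y) \<otimes>\<^bsub>A\<^esub> linear_ext \<rho> f')"
  proof (intro A.finsum_cong' refl)
    fix y assume y: "y \<in> mor H"
    have "(\<Oplus>\<^bsub>A\<^esub>z\<in>mor H. F (y, z))
        = (\<Oplus>\<^bsub>A\<^esub>z\<in>mor H. (f y \<odot>\<^bsub>A\<^esub> \<rho> y) \<otimes>\<^bsub>A\<^esub> (f' z \<odot>\<^bsub>A\<^esub> \<rho> z))"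
      using y fC rC by (intro A.finsum_cong') (auto simp: F_def smult_mult_smult)
    also have "\<dots> = (f y \<odot>\<^bsub>A\<^esub> \<rho> y) \<otimes>\<^bsub>A\<^esub> linear_ext \<rho> f'"
      unfolding linear_ext_def using y fC rC finite_H by (intro A.finsum_rdistr[symmetric]) auto
    finally show "(\<Oplus>\<^bsub>A\<^esub>z\<in>mor H. F (y, z)) = (f y \<odot>\<^bsub>A\<^esub> \<rho> y) \<otimes>\<^bsub>A\<^esub> linear_ext \<rho> f'" .
  qed (use fC rC in \<open>auto simp: linear_ext_def intro!: A.finsum_closed\<close>)
  also have "\<dots> = linear_ext \<rho> f \<otimes>\<^bsub>A\<^esub> linear_ext \<rho> f'"
    unfolding linear_ext_def[of \<rho> f]
    using fC rC finite_H by (intro A.finsum_ldistr[symmetric]) (auto simp: linear_ext_def)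
  finally show ?thesis .
qed

lemma linear_ext_hom:
  assumes rep: "groupoid_rep H A \<rho>"
  shows "linear_ext \<rho> \<in> algebra_hom K KH A"
proof -
  have rC: "\<rho> x \<in> carrier A" if "x \<in> mor H" for x
    using rep that by (auto simp: groupoid_rep_def)
  have "linear_ext \<rho> \<in> ring_hom KH A"
  proof (rule ring_hom_memI)
    fix f f' assume f: "f \<in> carrier KH" and f': "f' \<in> carrier KH"
    have fC: "f x \<in> carrier K" "f' x \<in> carrier K" for x using f f' by (simp_all add: carrier_KH)
    have "linear_ext \<rho> (f \<oplus>\<^bsub>KH\<^esub> f')
        = (\<Oplus>\<^bsub>A\<^esub>x\<in>mor H. (f x \<odot>\<^bsub>A\<^esub> \<rho> x) \<oplus>\<^bsub>A\<^esub> (f' x \<odot>\<^bsub>A\<^esub> \<rho> x))"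
      unfolding linear_ext_def using fC rC
      by (intro A.finsum_cong') (auto simp: KH_simps M.smult_l_distr)
    also have "\<dots> = linear_ext \<rho> f \<oplus>\<^bsub>A\<^esub> linear_ext \<rho> f'"
      unfolding linear_ext_def using fC rC by (intro A.finsum_addf) auto
    finally show "linear_ext \<rho> (f \<oplus>\<^bsub>KH\<^esub> f') = linear_ext \<rho> f \<oplus>\<^bsub>A\<^esub> linear_ext \<rho> f'" .
    show "linear_ext \<rho> (f \<otimes>\<^bsub>KH\<^esub> f') = linear_ext \<rho> f \<otimes>\<^bsub>A\<^esub> linear_ext \<rho> f'"
      by (rule linear_ext_mult[OF rep f f'])
  next
    fix f assume "f \<in> carrier KH"
    then show "linear_ext \<rho> f \<in> carrier A"
      using rC by (auto simp: linear_ext_def carrier_KH intro!: A.finsum_closed)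
  next
    have "linear_ext \<rho> \<one>\<^bsub>KH\<^esub> = (\<Oplus>\<^bsub>A\<^esub>x\<in>objs H. \<rho> x)"
      unfolding linear_ext_def using finite_H rC
      by (intro A.add.finprod_mono_neutral_cong_right) (auto simp: KH_simps objs_mor)
    then show "linear_ext \<rho> \<one>\<^bsub>KH\<^esub> = \<one>\<^bsub>A\<^esub>" using rep by (simp add: groupoid_rep_def)
  qed
  moreover have "linear_ext \<rho> (c \<odot>\<^bsub>KH\<^esub> f) = c \<odot>\<^bsub>A\<^esub> linear_ext \<rho> f"
    if c: "c \<in> carrier K" and f: "f \<in> carrier KH" for c f
  proof -
    have fC: "f x \<in> carrier K" for x using f by (simp add: carrier_KH)
    have "linear_ext \<rho> (c \<odot>\<^bsub>KH\<^esub> f) = (\<Oplus>\<^bsub>A\<^esub>x\<in>mor H. c \<odot>\<^bsub>A\<^esub> (f x \<odot>\<^bsub>A\<^esub> \<rho> x))"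
      unfolding linear_ext_def using c fC rC
      by (intro A.finsum_cong') (auto simp: KH_simps M.smult_assoc1)
    also have "\<dots> = c \<odot>\<^bsub>A\<^esub> linear_ext \<rho> f"
      unfolding linear_ext_def using c fC rC finite_H
      by (intro M.finsum_smult_ldistr[symmetric]) auto
    finally show ?thesis .
  qed
  ultimately show ?thesis by (simp add: algebra_hom_def)
qed

end


section \<open>Partial representations from representations of the expansion\<close>

locale finite_groupoid_ring = groupoid G + ring R for G :: "('g, 'x) groupoid_scheme"
  and R (structure) +
  assumes finite_mor: "finite (mor G)"
begin

abbreviation BR where "BR \<equiv> birget_rhodes G"

sublocale BR: groupoid BR by (rule groupoid_birget_rhodes)

lemma finite_BR: "finite (mor BR)" by (rule finite_mor_birget_rhodes[OF finite_mor])
lemma finite_objs: "finite (objs G)" using finite_mor by (auto simp: objs_def)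
lemma finite_objs_BR: "finite (objs BR)" using finite_BR by (auto simp: objs_def)

text \<open>The ring-theoretic form of composing with \<open>br_lambda\<close>, see \<open>hom_br_lambda\<close>.\<close>

definition partial_of_rep :: "('g set \<times> 'g \<Rightarrow> 'a) \<Rightarrow> 'g \<Rightarrow> 'a" where
  "partial_of_rep \<rho> g = (\<Oplus>A\<in>{A. (A, g) \<in> mor BR}. \<rho> (A, g))"

end

locale birget_rhodes_rep = finite_groupoid_ring +
  fixes \<rho>
  assumes rep: "groupoid_rep BR R \<rho>"
begin

abbreviation \<pi> where "\<pi> \<equiv> partial_of_rep \<rho>"

lemma rho_closed [simp]: "x \<in> mor BR \<Longrightarrow> \<rho> x \<in> carrier R"
  using rep by (auto simp: groupoid_rep_def)

lemma rho_mult: "\<lbrakk>x \<in> mor BR; y \<in> mor BR\<rbrakk> \<Longrightarrow>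
    \<rho> x \<otimes> \<rho> y = (if src BR x = trg BR y then \<rho> (x \<cdot>\<^bsub>BR\<^esub> y) else \<zero>)"
  using rep by (auto simp: groupoid_rep_def)

lemma rho_one: "(\<Oplus>x\<in>objs BR. \<rho> x) = \<one>"
  using rep by (auto simp: groupoid_rep_def)

lemma rho_objs: "\<rho> \<in> objs BR \<rightarrow> carrier R"
  by (auto simp: BR.objs_mor)

lemma finite_fibre: "finite {A. (A, g) \<in> mor BR}"
  by (rule finite_subset[OF _ finite_imageI[OF finite_BR, of fst]]) force

lemma pi_closed [simp]: "\<pi> g \<in> carrier R"
  unfolding partial_of_rep_def by (rule finsum_closed) auto

text \<open>Of all the products \<open>\<rho> (A, g) \<cdot> \<rho> (B, k)\<close> only the one with \<open>A = k B\<close> survives, and \<open>(k B, g)\<close>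
  belongs to the expansion iff \<open>g\<inverse> \<in> k B\<close>, that is, \<open>(g k)\<inverse> \<in> B\<close>.\<close>

lemma pi_act:
  assumes g: "g \<in> mor G" and x: "(B, k) \<in> mor BR"
  shows "\<pi> g \<otimes> \<rho> (B, k) =
    (if src G g = trg G k \<and> ginv G (g \<cdot>\<^bsub>G\<^esub> k) \<in> B then \<rho> (B, g \<cdot>\<^bsub>G\<^esub> k) else \<zero>)"
proof -
  let ?C = "(\<lambda>b. k \<cdot>\<^bsub>G\<^esub> b) ` B"
  have k: "k \<in> mor G" and B: "B \<subseteq> star_at G k" "src G k \<in> B" "ginv G k \<in> B"
    using x by (auto simp: mor_birget_rhodes)
  have "\<pi> g \<otimes> \<rho> (B, k) = (\<Oplus>A\<in>{A. (A, g) \<in> mor BR}. \<rho> (A, g) \<otimes> \<rho> (B, k))"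
    unfolding partial_of_rep_def using finite_fibre x by (intro finsum_ldistr) auto
  also have "\<dots> = (\<Oplus>A\<in>{A. (A, g) \<in> mor BR}.
      if A = ?C \<and> src G g = trg G k then \<rho> (B, g \<cdot>\<^bsub>G\<^esub> k) else \<zero>)"
  proof (intro finsum_cong' refl)
    fix A assume A: "A \<in> {A. (A, g) \<in> mor BR}"
    then show "\<rho> (A, g) \<otimes> \<rho> (B, k) =
        (if A = ?C \<and> src G g = trg G k then \<rho> (B, g \<cdot>\<^bsub>G\<^esub> k) else \<zero>)"
      using x by (simp add: rho_mult)
  next
    have "(B, g \<cdot>\<^bsub>G\<^esub> k) \<in> mor BR" if "(?C, g) \<in> mor BR" "src G g = trg G k"
      using BR.cmp_closed[OF that(1) x] that by simp
    then show "(\<lambda>A. if A = ?C \<and> src G g = trg G k then \<rho> (B, g \<cdot>\<^bsub>G\<^esub> k) else \<zero>)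
        \<in> {A. (A, g) \<in> mor BR} \<rightarrow> carrier R" by auto
  qed
  also have "\<dots> = (if src G g = trg G k \<and> (?C, g) \<in> mor BR then \<rho> (B, g \<cdot>\<^bsub>G\<^esub> k) else \<zero>)"
  proof (cases "src G g = trg G k \<and> (?C, g) \<in> mor BR")
    case True
    then have "(B, g \<cdot>\<^bsub>G\<^esub> k) \<in> mor BR" using BR.cmp_closed[of "(?C, g)", OF _ x] by simp
    then show ?thesis using True finsum_eq_single[OF finite_fibre, of ?C g] by simp
  next
    case False
    then show ?thesis by (auto intro!: add.finprod_one_eqI)
  qed
  also have "(src G g = trg G k \<and> (?C, g) \<in> mor BR) \<longleftrightarrow>
      (src G g = trg G k \<and> ginv G (g \<cdot>\<^bsub>G\<^esub> k) \<in> B)"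
  proof (rule conj_cong[OF refl])
    assume gk: "src G g = trg G k"
    have "?C \<subseteq> star_at G g"
      using B k gk by (auto simp: star_at_def cmp_closed trg_cmp)
    moreover have "src G g \<in> ?C" using B(3) ginv(5)[OF k] gk by (metis image_eqI)
    moreover have "ginv G g \<in> ?C \<longleftrightarrow> ginv G (g \<cdot>\<^bsub>G\<^esub> k) \<in> B"
    proof
      assume "ginv G g \<in> ?C"
      then obtain b where b: "b \<in> B" "ginv G g = k \<cdot>\<^bsub>G\<^esub> b" by auto
      then have "b = ginv G k \<cdot>\<^bsub>G\<^esub> ginv G g"
        using B(1) k cmp_cancel_left[of k b] by (auto simp: star_at_def)
      then show "ginv G (g \<cdot>\<^bsub>G\<^esub> k) \<in> B" using b ginv_cmp[OF g k gk] by simp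
    next
      assume "ginv G (g \<cdot>\<^bsub>G\<^esub> k) \<in> B"
      moreover have "ginv G g = k \<cdot>\<^bsub>G\<^esub> ginv G (g \<cdot>\<^bsub>G\<^esub> k)"
        using ginv_cmp[OF g k gk] cmp_cancel_left'[of k "ginv G g"] ginv[OF g] k gk by simp
      ultimately show "ginv G g \<in> ?C" by blast
    qed
    ultimately show "(?C, g) \<in> mor BR \<longleftrightarrow> ginv G (g \<cdot>\<^bsub>G\<^esub> k) \<in> B"
      using g by (simp add: mor_birget_rhodes)
  qed
  finally show ?thesis .
qed


lemma path_mor:
  assumes "(B, e) \<in> objs BR" "k \<in> mor G" "src G k = e" "ginv G k \<in> B"
  shows "(B, k) \<in> mor BR"
  using assms by (auto simp: objs_birget_rhodes mor_birget_rhodes star_at_def objs_src)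

lemma obj_mem:
  assumes "(B, e) \<in> objs BR" "b \<in> B"
  shows "b \<in> mor G" "trg G b = e"
  using assms by (auto simp: objs_birget_rhodes star_at_def objs_src)

lemma pi_act_obj:
  assumes "g \<in> mor G" "(B, e) \<in> objs BR"
  shows "\<pi> g \<otimes> \<rho> (B, e) = (if ginv G g \<in> B then \<rho> (B, g) else \<zero>)"
proof -
  have "e \<in> objs G" using assms by (simp add: objs_birget_rhodes)
  moreover have "ginv G g \<in> B \<Longrightarrow> src G g = e"
    using obj_mem[OF assms(2)] ginv(3)[OF assms(1)] by simp
  ultimately show ?thesis
    using pi_act[OF assms(1) BR.objs_mor[OF assms(2)]] cmp_src[OF assms(1)]
    by (auto simp: objs_trg)
qed

text \<open>If \<open>g \<in> B\<close>, then \<open>g\<inverse>\<close> translates \<open>(B, e)\<close> to \<open>(B, g\<inverse>)\<close> and \<open>g\<close> takes this back to \<open>(B, e)\<close>. So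
  membership in \<open>B\<close> is an eigenvalue on \<open>\<rho> (B, e)\<close>.\<close>

lemma eps_act:
  assumes "g \<in> mor G" "(B, e) \<in> objs BR"
  shows "\<pi> g \<otimes> (\<pi> (ginv G g) \<otimes> \<rho> (B, e)) = (if g \<in> B then \<rho> (B, e) else \<zero>)"
proof (cases "g \<in> B")
  case True
  then have "(B, ginv G g) \<in> mor BR" "trg G g = e" "e \<in> objs G" "e \<in> B"
    using assms ginv[OF assms(1)] obj_mem[OF assms(2)]
    by (auto intro!: path_mor simp: ginv_ginv objs_birget_rhodes)
  then show ?thesis
    using True assms ginv[OF assms(1)] by (simp add: pi_act_obj ginv_ginv pi_act objs_ginv)
next
  case False
  then show ?thesis using assms ginv[OF assms(1)] by (simp add: pi_act_obj ginv_ginv)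
qed

lemma eqI_on_objs:
  assumes "u \<in> carrier R" "v \<in> carrier R"
    and "\<And>B e. (B, e) \<in> objs BR \<Longrightarrow> u \<otimes> \<rho> (B, e) = v \<otimes> \<rho> (B, e)"
  shows "u = v"
  using one_sum_ext[OF finite_objs_BR rho_objs rho_one assms(1,2)] assms(3) by auto

text \<open>Each axiom is tested on the \<open>\<rho> (B, e)\<close>. The two sides of the first three axioms then are
  sequences of translations with the same endpoint, and it remains to compare when they
  are nonzero. In the first axiom both sides require \<open>h \<in> B\<close> and \<open>g\<inverse> \<in> B\<close>, in the second
  \<open>h\<inverse> \<in> B\<close> and \<open>(g h)\<inverse> \<in> B\<close>: all further intermediate stops are repetitions or the object
  itself.\<close>

lemma partial_groupoid_rep: "partial_groupoid_rep G R \<pi>"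
  unfolding partial_groupoid_rep_def
proof (intro conjI ballI impI)
  show "\<pi> \<in> mor G \<rightarrow> carrier R" by simp
next
  fix g h assume gh: "g \<in> mor G" "h \<in> mor G" "src G g = trg G h"
  show "\<pi> g \<otimes> \<pi> h \<otimes> \<pi> (ginv G h) = \<pi> (g \<cdot>\<^bsub>G\<^esub> h) \<otimes> \<pi> (ginv G h)"
  proof (rule eqI_on_objs)
    fix B e assume B: "(B, e) \<in> objs BR"
    have "\<pi> g \<otimes> (\<pi> h \<otimes> (\<pi> (ginv G h) \<otimes> \<rho> (B, e)))
        = \<pi> (g \<cdot>\<^bsub>G\<^esub> h) \<otimes> (\<pi> (ginv G h) \<otimes> \<rho> (B, e))"
    proof (cases "h \<in> B")
      case True
      then have "(B, ginv G h) \<in> mor BR"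
        using B gh ginv[OF gh(2)] obj_mem[OF B] by (auto intro!: path_mor simp: ginv_ginv)
      moreover have "trg G h = e" "e \<in> B" "ginv G e = e"
        using True B obj_mem[OF B] by (auto simp: objs_birget_rhodes objs_ginv)
      ultimately show ?thesis
        using True B gh ginv[OF gh(2)]
        by (simp add: eps_act pi_act_obj pi_act ginv_ginv cmp_closed src_cmp cmp_cancel_right)
    qed (use B gh ginv[OF gh(2)] in \<open>simp add: pi_act_obj ginv_ginv cmp_closed\<close>)
    then show "\<pi> g \<otimes> \<pi> h \<otimes> \<pi> (ginv G h) \<otimes> \<rho> (B, e)
        = \<pi> (g \<cdot>\<^bsub>G\<^esub> h) \<otimes> \<pi> (ginv G h) \<otimes> \<rho> (B, e)"
      using BR.objs_mor[OF B] by (simp add: m_assoc)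
  qed auto
  show "\<pi> (ginv G g) \<otimes> \<pi> g \<otimes> \<pi> h = \<pi> (ginv G g) \<otimes> \<pi> (g \<cdot>\<^bsub>G\<^esub> h)"
  proof (rule eqI_on_objs)
    fix B e assume B: "(B, e) \<in> objs BR"
    have *: "(B, k) \<in> mor BR" if "ginv G k \<in> B" "k \<in> mor G" for k
      using B that ginv[OF that(2)] obj_mem[OF B] by (auto intro!: path_mor)
    have "\<pi> (ginv G g) \<otimes> (\<pi> g \<otimes> (\<pi> h \<otimes> \<rho> (B, e)))
        = \<pi> (ginv G g) \<otimes> (\<pi> (g \<cdot>\<^bsub>G\<^esub> h) \<otimes> \<rho> (B, e))"
      using B gh ginv[OF gh(1)] *[of h] *[of "g \<cdot>\<^bsub>G\<^esub> h"]
      by (simp add: pi_act_obj pi_act cmp_closed src_cmp trg_cmp cmp_cancel_left)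
    then show "\<pi> (ginv G g) \<otimes> \<pi> g \<otimes> \<pi> h \<otimes> \<rho> (B, e)
        = \<pi> (ginv G g) \<otimes> \<pi> (g \<cdot>\<^bsub>G\<^esub> h) \<otimes> \<rho> (B, e)"
      using BR.objs_mor[OF B] by (simp add: m_assoc)
  qed auto
next
  fix g assume g: "g \<in> mor G"
  show "\<pi> g \<otimes> \<pi> (ginv G g) \<otimes> \<pi> g = \<pi> g"
  proof (rule eqI_on_objs)
    fix B e assume B: "(B, e) \<in> objs BR"
    have "\<pi> g \<otimes> (\<pi> (ginv G g) \<otimes> (\<pi> g \<otimes> \<rho> (B, e))) = \<pi> g \<otimes> \<rho> (B, e)"
      using eps_act[of "ginv G g" B e] B g ginv[OF g] by (simp add: pi_act_obj ginv_ginv)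
    then show "\<pi> g \<otimes> \<pi> (ginv G g) \<otimes> \<pi> g \<otimes> \<rho> (B, e) = \<pi> g \<otimes> \<rho> (B, e)"
      using BR.objs_mor[OF B] by (simp add: m_assoc)
  qed auto
next
  have obj: "\<pi> e \<otimes> \<rho> (B, f) = (if e = f then \<rho> (B, f) else \<zero>)"
    if B: "(B, f) \<in> objs BR" and e: "e \<in> objs G" for B e f
  proof -
    have "f \<in> B" using B by (simp add: objs_birget_rhodes)
    then have "e \<in> B \<longleftrightarrow> e = f" using obj_mem[OF B, of e] objs_trg[OF e] by auto
    then show ?thesis using pi_act_obj[OF objs_mor[OF e] B] objs_ginv[OF e] by auto
  qed
  show "(\<Oplus>e\<in>objs G. \<pi> e) = \<one>"
  proof (rule eqI_on_objs)
    fix B f assume B: "(B, f) \<in> objs BR"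
    then have f: "f \<in> objs G" by (simp add: objs_birget_rhodes)
    have "(\<Oplus>e\<in>objs G. \<pi> e) \<otimes> \<rho> (B, f) = (\<Oplus>e\<in>objs G. \<pi> e \<otimes> \<rho> (B, f))"
      using finite_objs BR.objs_mor[OF B] by (intro finsum_ldistr) auto
    also have "\<dots> = \<pi> f \<otimes> \<rho> (B, f)"
      using finite_objs f obj[OF B] BR.objs_mor[OF B] by (intro finsum_eq_single) auto
    finally show "(\<Oplus>e\<in>objs G. \<pi> e) \<otimes> \<rho> (B, f) = \<one> \<otimes> \<rho> (B, f)"
      using obj[OF B f] BR.objs_mor[OF B] by simp
  qed auto
  show "\<pi> e \<otimes> \<pi> f = \<zero>" if "e \<in> objs G" "f \<in> objs G" "e \<noteq> f" for e f
  proof (rule eqI_on_objs)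
    fix B k assume B: "(B, k) \<in> objs BR"
    have "\<pi> e \<otimes> (\<pi> f \<otimes> \<rho> (B, k)) = \<zero>"
      using that by (cases "f = k") (simp_all add: obj[OF B])
    then show "\<pi> e \<otimes> \<pi> f \<otimes> \<rho> (B, k) = \<zero> \<otimes> \<rho> (B, k)"
      using BR.objs_mor[OF B] by (simp add: m_assoc)
  qed auto
qed

lemma rho_orth:
  assumes "x \<in> objs BR" "y \<in> objs BR"
  shows "\<rho> x \<otimes> \<rho> y = (if x = y then \<rho> x else \<zero>)"
  using assms BR.objs_cmp(1)[OF assms] BR.objs_cmp(2)[OF assms(1,1)] rho_mult[of x y]
  by (cases "x = y") (auto simp: BR.objs_mor)

lemma eps_act_right:
  assumes g: "g \<in> mor G" and B: "(B, e) \<in> objs BR"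
  shows "\<rho> (B, e) \<otimes> (\<pi> g \<otimes> \<pi> (ginv G g)) = (if g \<in> B then \<rho> (B, e) else \<zero>)"
proof (rule eqI_on_objs)
  fix C f assume C: "(C, f) \<in> objs BR"
  have "\<rho> (B, e) \<otimes> (\<pi> g \<otimes> (\<pi> (ginv G g) \<otimes> \<rho> (C, f)))
      = (if g \<in> B then \<rho> (B, e) else \<zero>) \<otimes> \<rho> (C, f)"
    using B C g BR.objs_mor[OF B] BR.objs_mor[OF C] by (auto simp: eps_act rho_orth)
  then show "\<rho> (B, e) \<otimes> (\<pi> g \<otimes> \<pi> (ginv G g)) \<otimes> \<rho> (C, f)
      = (if g \<in> B then \<rho> (B, e) else \<zero>) \<otimes> \<rho> (C, f)"
    using BR.objs_mor[OF B] BR.objs_mor[OF C] by (simp add: m_assoc)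
qed (use BR.objs_mor[OF B] in auto)

text \<open>As \<open>g\<inverse> \<in> A\<close>, translating the object \<open>(A, d g)\<close> by \<open>g\<close> is allowed.\<close>

lemma rho_decomp:
  assumes "(A, g) \<in> mor BR"
  shows "(A, src G g) \<in> objs BR" "\<rho> (A, g) = \<pi> g \<otimes> \<rho> (A, src G g)"
proof -
  show *: "(A, src G g) \<in> objs BR" using BR.src_objs[OF assms] by simp
  show "\<rho> (A, g) = \<pi> g \<otimes> \<rho> (A, src G g)"
    using assms * by (simp add: pi_act_obj mor_birget_rhodes)
qed

end

text \<open>On objects, \<open>\<rho>\<close> and \<open>\<sigma>\<close> are eigendecompositions of \<open>1\<close> for the same idempotents. If \<open>A \<noteq> B\<close>, an
  element \<open>a\<close> of just one of the two sets has different eigenvalues on \<open>\<rho> (A, e)\<close> and \<open>\<sigma> (B, f)\<close>,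
  which makes their product zero. Therefore \<open>\<rho> (A, e) = \<rho> (A, e) \<cdot> \<sigma> (A, e) = \<sigma> (A, e)\<close>.\<close>

lemma (in finite_groupoid_ring) rep_eq_of_partial_eq:
  assumes "groupoid_rep BR R \<rho>" "groupoid_rep BR R \<sigma>"
    and eq: "\<And>g. g \<in> mor G \<Longrightarrow> partial_of_rep \<rho> g = partial_of_rep \<sigma> g"
    and x: "x \<in> mor BR"
  shows "\<rho> x = \<sigma> x"
proof -
  interpret P: birget_rhodes_rep G R \<rho> by unfold_locales fact
  interpret Q: birget_rhodes_rep G R \<sigma> by unfold_locales fact
  have orth: "\<rho> (A, e) \<otimes> \<sigma> (B, f) = \<zero>"
    if A: "(A, e) \<in> objs BR" and B: "(B, f) \<in> objs BR" and ne: "(A, e) \<noteq> (B, f)" for A e B f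
  proof -
    have C: "\<rho> (A, e) \<in> carrier R" "\<sigma> (B, f) \<in> carrier R"
      using A B by (auto simp: BR.objs_mor)
    \<comment> \<open>The object \<open>e\<close> is the common range of the elements of \<open>A\<close>.\<close>
    have "A \<noteq> B"
    proof
      assume "A = B"
      moreover have "e \<in> A" "e \<in> objs G" using A by (auto simp: objs_birget_rhodes)
      ultimately have "e = f" using P.obj_mem[OF B, of e] by (simp add: objs_trg)
      then show False using ne \<open>A = B\<close> by simp
    qed
    then obtain a where a: "a \<in> A \<longleftrightarrow> a \<notin> B" by blast
    then have am: "a \<in> mor G" using P.obj_mem[OF A] P.obj_mem[OF B] by blast
    let ?e = "partial_of_rep \<rho> a \<otimes> partial_of_rep \<rho> (ginv G a)"
    have "\<rho> (A, e) \<otimes> ?e \<otimes> \<sigma> (B, f) = \<rho> (A, e) \<otimes> (?e \<otimes> \<sigma> (B, f))"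
      using C by (simp add: m_assoc)
    moreover have "?e \<otimes> \<sigma> (B, f) = (if a \<in> B then \<sigma> (B, f) else \<zero>)"
      using Q.eps_act[OF am B] eq[OF am] eq[OF ginv(1)[OF am]] C by (simp add: m_assoc)
    ultimately show ?thesis
      using P.eps_act_right[OF am A] a C by (auto split: if_splits)
  qed
  then have orth: "\<rho> x \<otimes> \<sigma> y = \<zero>" if "x \<in> objs BR" "y \<in> objs BR" "x \<noteq> y" for x y
    using that by (cases x; cases y) auto
  have obj: "\<rho> y = \<sigma> y" if y: "y \<in> objs BR" for y
  proof -
    have "\<rho> y \<otimes> \<sigma> y = \<sigma> y"
      using y orth BR.objs_mor by (intro one_sum_absorb_left[OF finite_objs_BR P.rho_objs P.rho_one]) auto
    moreover have "\<rho> y \<otimes> \<sigma> y = \<rho> y"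
      using y orth BR.objs_mor by (intro one_sum_absorb_right[OF finite_objs_BR Q.rho_objs Q.rho_one]) auto
    ultimately show ?thesis by simp
  qed
  obtain A g where Ag: "x = (A, g)" by (cases x)
  then have "g \<in> mor G" using x by (simp add: mor_birget_rhodes)
  then show ?thesis
    using P.rho_decomp[of A g] Q.rho_decomp[of A g] x Ag obj eq by simp
qed


section \<open>From partial representations to the expansion\<close>

locale partial_rep = finite_groupoid_ring +
  fixes \<pi>
  assumes partial: "partial_groupoid_rep G R \<pi>"
begin

lemma pi_closed [simp]: "g \<in> mor G \<Longrightarrow> \<pi> g \<in> carrier R"
  using partial by (auto simp: partial_groupoid_rep_def)

lemma pi_ginv_closed [simp]: "g \<in> mor G \<Longrightarrow> \<pi> (ginv G g) \<in> carrier R"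
  using ginv(1) by simp

lemma
  assumes "g \<in> mor G" "h \<in> mor G" "src G g = trg G h"
  shows pi_mult_right: "\<pi> g \<otimes> (\<pi> h \<otimes> \<pi> (ginv G h)) = \<pi> (g \<cdot>\<^bsub>G\<^esub> h) \<otimes> \<pi> (ginv G h)"
    and pi_mult_left: "\<pi> (ginv G g) \<otimes> \<pi> g \<otimes> \<pi> h = \<pi> (ginv G g) \<otimes> \<pi> (g \<cdot>\<^bsub>G\<^esub> h)"
  using partial assms by (auto simp: partial_groupoid_rep_def m_assoc[symmetric])

lemma pi_regular: "g \<in> mor G \<Longrightarrow> \<pi> g \<otimes> \<pi> (ginv G g) \<otimes> \<pi> g = \<pi> g"
  and pi_one: "(\<Oplus>e\<in>objs G. \<pi> e) = \<one>"
  and pi_orth: "\<lbrakk>e \<in> objs G; f \<in> objs G; e \<noteq> f\<rbrakk> \<Longrightarrow> \<pi> e \<otimes> \<pi> f = \<zero>"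
  using partial by (auto simp: partial_groupoid_rep_def)

definition \<epsilon> where "\<epsilon> a = \<pi> a \<otimes> \<pi> (ginv G a)"

lemma eps_closed [simp]: "a \<in> mor G \<Longrightarrow> \<epsilon> a \<in> carrier R"
  by (simp add: \<epsilon>_def)

lemma eps_pi: "a \<in> mor G \<Longrightarrow> \<epsilon> a \<otimes> \<pi> a = \<pi> a"
  by (simp add: \<epsilon>_def pi_regular)

lemma eps_idem: "a \<in> mor G \<Longrightarrow> \<epsilon> a \<otimes> \<epsilon> a = \<epsilon> a"
  using eps_pi[of a] by (simp add: \<epsilon>_def m_assoc[symmetric])

lemma pi_src:
  assumes g: "g \<in> mor G"
  shows "\<pi> g \<otimes> \<pi> (src G g) = \<pi> g"
proof -
  have *: "\<pi> (ginv G g) \<otimes> \<pi> g \<otimes> \<pi> (src G g) = \<pi> (ginv G g) \<otimes> \<pi> g"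
    using pi_mult_left[of g "src G g"] g by (simp add: cmp_src src_closed trg_src)
  have "\<pi> g \<otimes> \<pi> (src G g) = \<pi> g \<otimes> (\<pi> (ginv G g) \<otimes> \<pi> g \<otimes> \<pi> (src G g))"
    using g pi_regular[OF g] by (simp add: m_assoc[symmetric] src_closed)
  also have "\<dots> = \<pi> g" unfolding * using g pi_regular[OF g] by (simp add: m_assoc[symmetric])
  finally show ?thesis .
qed

lemma pi_trg:
  assumes g: "g \<in> mor G"
  shows "\<pi> (trg G g) \<otimes> \<pi> g = \<pi> g"
proof -
  have *: "\<pi> (trg G g) \<otimes> \<epsilon> g = \<epsilon> g"
    using pi_mult_right[of "trg G g" g] g by (simp add: trg_cmp_id trg_closed src_trg \<epsilon>_def)
  have "\<pi> (trg G g) \<otimes> \<pi> g = (\<pi> (trg G g) \<otimes> \<epsilon> g) \<otimes> \<pi> g"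
    using g by (simp add: eps_pi m_assoc trg_closed)
  then show ?thesis using g by (simp add: * eps_pi)
qed

text \<open>\<open>\<pi> g\<close> absorbs \<open>\<pi> (d g)\<close> on its right, \<open>\<pi> h\<close> absorbs \<open>\<pi> (r h)\<close> on its left, and distinct
  objects are orthogonal.\<close>

lemma pi_mult_zero:
  assumes "g \<in> mor G" "h \<in> mor G" "src G g \<noteq> trg G h"
  shows "\<pi> g \<otimes> \<pi> h = \<zero>"
proof -
  have "\<pi> g \<otimes> \<pi> h = (\<pi> g \<otimes> \<pi> (src G g)) \<otimes> (\<pi> (trg G h) \<otimes> \<pi> h)"
    using assms by (simp add: pi_src pi_trg)
  also have "\<dots> = \<pi> g \<otimes> (\<pi> (src G g) \<otimes> \<pi> (trg G h)) \<otimes> \<pi> h"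
    using assms by (simp add: m_assoc src_closed trg_closed)
  finally show ?thesis using assms by (simp add: pi_orth src_objs trg_objs)
qed

lemma eps_pi_zero:
  assumes "a \<in> mor G" "h \<in> mor G" "trg G a \<noteq> trg G h"
  shows "\<epsilon> a \<otimes> \<pi> h = \<zero>"
  using assms ginv[OF assms(1)] by (simp add: \<epsilon>_def m_assoc pi_mult_zero)

lemma pi_eps_zero:
  assumes "a \<in> mor G" "h \<in> mor G" "src G h \<noteq> trg G a"
  shows "\<pi> h \<otimes> \<epsilon> a = \<zero>"
  using assms by (simp add: \<epsilon>_def m_assoc[symmetric] pi_mult_zero)

lemma eps_obj: "e \<in> objs G \<Longrightarrow> \<epsilon> e = \<pi> e"
  using pi_src[of e] by (simp add: \<epsilon>_def objs_ginv objs_src objs_mor)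

text \<open>With \<open>k = g h\<close>, the first axiom rewrites \<open>\<pi> g \<pi> h \<pi> (h\<inverse>)\<close> as \<open>\<pi> k \<pi> (h\<inverse>)\<close>; regularity
  inserts \<open>\<pi> k \<pi> (k\<inverse>)\<close> in front, and the second axiom contracts \<open>\<pi> (k\<inverse>) \<pi> k \<pi> (h\<inverse>)\<close> to
  \<open>\<pi> (k\<inverse>) \<pi> g\<close>.\<close>

lemma pi_eps:
  assumes gh: "g \<in> mor G" "h \<in> mor G" "src G g = trg G h"
  shows "\<pi> g \<otimes> \<epsilon> h = \<epsilon> (g \<cdot>\<^bsub>G\<^esub> h) \<otimes> \<pi> g"
proof -
  let ?k = "g \<cdot>\<^bsub>G\<^esub> h"
  have k: "?k \<in> mor G" using gh by (simp add: cmp_closed)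
  have "\<pi> g \<otimes> \<epsilon> h = \<pi> ?k \<otimes> \<pi> (ginv G h)" using pi_mult_right[OF gh] by (simp add: \<epsilon>_def)
  also have "\<dots> = \<pi> ?k \<otimes> (\<pi> (ginv G ?k) \<otimes> \<pi> ?k \<otimes> \<pi> (ginv G h))"
    using eps_pi[OF k] k gh by (simp add: \<epsilon>_def m_assoc[symmetric])
  also have "\<pi> (ginv G ?k) \<otimes> \<pi> ?k \<otimes> \<pi> (ginv G h) = \<pi> (ginv G ?k) \<otimes> \<pi> g"
    using pi_mult_left[OF k ginv(1)[OF gh(2)]] gh ginv[OF gh(2)]
    by (simp add: src_cmp cmp_cancel_right)
  finally show ?thesis using gh k by (simp add: \<epsilon>_def m_assoc)
qed

text \<open>For \<open>a\<close> and \<open>b\<close> with a common range, \<open>\<epsilon> b\<close> moves past \<open>\<pi> (a\<inverse>)\<close> by becoming \<open>\<epsilon> (a\<inverse> b)\<close>, and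
  past \<open>\<pi> a\<close> by becoming \<open>\<epsilon> b\<close> again.\<close>

lemma eps_commute:
  assumes "a \<in> mor G" "b \<in> mor G"
  shows "\<epsilon> a \<otimes> \<epsilon> b = \<epsilon> b \<otimes> \<epsilon> a"
proof (cases "trg G a = trg G b")
  case True
  let ?c = "ginv G a \<cdot>\<^bsub>G\<^esub> b"
  note ia = ginv[OF assms(1)]
  have c: "?c \<in> mor G" "src G a = trg G ?c" "a \<cdot>\<^bsub>G\<^esub> ?c = b"
    using assms ia True by (simp_all add: cmp_closed trg_cmp cmp_cancel_left')
  have "\<epsilon> a \<otimes> \<epsilon> b = \<pi> a \<otimes> (\<pi> (ginv G a) \<otimes> \<epsilon> b)"
    using assms by (simp add: \<epsilon>_def m_assoc)
  also have "\<pi> (ginv G a) \<otimes> \<epsilon> b = \<epsilon> ?c \<otimes> \<pi> (ginv G a)"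
    using assms ia True by (intro pi_eps) auto
  also have "\<pi> a \<otimes> (\<epsilon> ?c \<otimes> \<pi> (ginv G a)) = (\<pi> a \<otimes> \<epsilon> ?c) \<otimes> \<pi> (ginv G a)"
    using assms c by (simp add: m_assoc)
  also have "\<pi> a \<otimes> \<epsilon> ?c = \<epsilon> b \<otimes> \<pi> a"
    using pi_eps[OF assms(1) c(1,2)] c(3) by simp
  finally show ?thesis using assms by (simp add: \<epsilon>_def m_assoc)
next
  case False
  then show ?thesis
    using assms eps_pi_zero[of a b] eps_pi_zero[of b a]
    by (simp add: \<epsilon>_def[of b] \<epsilon>_def[of a] m_assoc[symmetric])
qed

text \<open>The family is indexed by all sets of morphisms, and not by the objects of the expansion,
  because this is what the Boolean algebra of all \<open>\<epsilon> a\<close> provides; the superfluous members are zero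
  by \<open>atom_nonzero\<close>.\<close>

definition atom where
  "atom = (SOME P. P \<in> Pow (mor G) \<rightarrow> carrier R \<and> (\<Oplus>A\<in>Pow (mor G). P A) = \<one> \<and>
    (\<forall>A\<in>Pow (mor G). \<forall>a\<in>mor G. \<epsilon> a \<otimes> P A = (if a \<in> A then P A else \<zero>) \<and>
       P A \<otimes> \<epsilon> a = (if a \<in> A then P A else \<zero>)))"

lemma atom:
  shows atom_Pi: "atom \<in> Pow (mor G) \<rightarrow> carrier R"
    and atom_one: "(\<Oplus>A\<in>Pow (mor G). atom A) = \<one>"
    and eps_atom: "\<And>a A. \<lbrakk>A \<subseteq> mor G; a \<in> mor G\<rbrakk> \<Longrightarrow> \<epsilon> a \<otimes> atom A = (if a \<in> A then atom A else \<zero>)"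
    and atom_eps: "\<And>a A. \<lbrakk>A \<subseteq> mor G; a \<in> mor G\<rbrakk> \<Longrightarrow> atom A \<otimes> \<epsilon> a = (if a \<in> A then atom A else \<zero>)"
proof -
  obtain P where P: "P \<in> Pow (mor G) \<rightarrow> carrier R" "(\<Oplus>A\<in>Pow (mor G). P A) = \<one>"
    and eig: "\<forall>A\<in>Pow (mor G). \<forall>a\<in>mor G. \<epsilon> a \<otimes> P A = (if a \<in> A then P A else \<zero>)"
    and comm: "\<And>y A. \<lbrakk>y \<in> carrier R; \<forall>a\<in>mor G. y \<otimes> \<epsilon> a = \<epsilon> a \<otimes> y; A \<subseteq> mor G\<rbrakk>
      \<Longrightarrow> y \<otimes> P A = P A \<otimes> y"
    using commuting_idempotents_atoms[OF finite_mor, of \<epsilon>] eps_idem eps_commute by auto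
  have "\<exists>P. P \<in> Pow (mor G) \<rightarrow> carrier R \<and> (\<Oplus>A\<in>Pow (mor G). P A) = \<one> \<and>
    (\<forall>A\<in>Pow (mor G). \<forall>a\<in>mor G. \<epsilon> a \<otimes> P A = (if a \<in> A then P A else \<zero>) \<and>
       P A \<otimes> \<epsilon> a = (if a \<in> A then P A else \<zero>))"
    using P eig comm[OF eps_closed] eps_commute by (intro exI[of _ P]) (auto simp: subset_iff)
  from someI_ex[OF this, folded atom_def]
  show "atom \<in> Pow (mor G) \<rightarrow> carrier R" "(\<Oplus>A\<in>Pow (mor G). atom A) = \<one>"
    "\<And>a A. \<lbrakk>A \<subseteq> mor G; a \<in> mor G\<rbrakk> \<Longrightarrow> \<epsilon> a \<otimes> atom A = (if a \<in> A then atom A else \<zero>)"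
    "\<And>a A. \<lbrakk>A \<subseteq> mor G; a \<in> mor G\<rbrakk> \<Longrightarrow> atom A \<otimes> \<epsilon> a = (if a \<in> A then atom A else \<zero>)"
    by auto
qed

lemma atom_closed [simp]: "A \<subseteq> mor G \<Longrightarrow> atom A \<in> carrier R"
  using atom_Pi by auto

lemma atom_orth:
  assumes "A \<subseteq> mor G" "B \<subseteq> mor G" "A \<noteq> B"
  shows "atom A \<otimes> atom B = \<zero>"
proof -
  from assms obtain a where a: "a \<in> mor G" "a \<in> A \<longleftrightarrow> a \<notin> B" by blast
  have "(atom A \<otimes> \<epsilon> a) \<otimes> atom B = atom A \<otimes> (\<epsilon> a \<otimes> atom B)"
    using assms a by (simp add: m_assoc)
  then show ?thesis using assms a by (auto simp: eps_atom atom_eps split: if_splits)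
qed

lemma finite_Pow: "finite (Pow (mor G))" using finite_mor by simp

lemma atom_idem:
  assumes "A \<subseteq> mor G"
  shows "atom A \<otimes> atom A = atom A"
  using assms atom_orth by (intro one_sum_absorb_left[OF finite_Pow atom_Pi atom_one]) auto

text \<open>If \<open>A\<close> contains no object, then \<open>atom A = (\<Sum>e. \<pi> e) \<cdot> atom A = 0\<close>, because \<open>\<pi> e = \<epsilon> e\<close>. If \<open>A\<close>
  contains the object \<open>e\<close> and some \<open>a\<close> with another range, then \<open>atom A = \<epsilon> a \<cdot> \<epsilon> e \<cdot> atom A\<close>, where
  \<open>\<epsilon> a \<cdot> \<epsilon> e = 0\<close>.\<close>

lemma atom_nonzero:
  assumes A: "A \<subseteq> mor G" and nz: "atom A \<noteq> \<zero>"
  shows "\<exists>e. (A, e) \<in> objs BR"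
proof -
  have "\<exists>e\<in>objs G. e \<in> A"
  proof (rule ccontr)
    assume no: "\<not> (\<exists>e\<in>objs G. e \<in> A)"
    have "atom A = (\<Oplus>e\<in>objs G. \<pi> e) \<otimes> atom A" using A by (simp add: pi_one)
    also have "\<dots> = (\<Oplus>e\<in>objs G. \<pi> e \<otimes> atom A)"
      using A finite_objs objs_mor by (intro finsum_ldistr) auto
    also have "\<dots> = \<zero>"
      using no A eps_atom[OF A] objs_mor by (intro add.finprod_one_eqI) (metis eps_obj)
    finally show False using nz by simp
  qed
  then obtain e where e: "e \<in> objs G" "e \<in> A" by blast
  have "trg G a = e" if "a \<in> A" for a
  proof (rule ccontr)
    assume ne: "trg G a \<noteq> e"
    have a: "a \<in> mor G" using that A by auto
    have "atom A = \<epsilon> a \<otimes> (\<epsilon> e \<otimes> atom A)"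
      using A a e that by (simp add: eps_atom objs_mor)
    also have "\<dots> = (\<epsilon> a \<otimes> \<pi> e) \<otimes> atom A"
      using A a e by (simp add: eps_obj m_assoc objs_mor)
    also have "\<dots> = \<zero>" using A a e ne by (simp add: eps_pi_zero objs_mor objs_trg)
    finally show False using nz by simp
  qed
  then have "(A, e) \<in> objs BR" using e A by (auto simp: objs_birget_rhodes star_at_def objs_src)
  then show ?thesis by blast
qed

text \<open>An eigenvalue comparison: \<open>\<epsilon> (h b) \<cdot> \<pi> h = \<pi> h \<cdot> \<epsilon> b\<close> may be evaluated against
  \<open>atom C\<close> on its left and against \<open>atom B\<close> on its right, so \<open>h b \<in> C\<close> iff \<open>b \<in> B\<close>. An element of \<open>B\<close> or
  \<open>C\<close> in the wrong star is excluded because its idempotent annihilates \<open>\<pi> h\<close>.\<close>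

lemma atom_pi_atom_nonzero:
  assumes B: "B \<subseteq> mor G" and C: "C \<subseteq> mor G" and h: "h \<in> mor G"
    and nz: "atom C \<otimes> (\<pi> h \<otimes> atom B) \<noteq> \<zero>"
  shows "B \<subseteq> star_at G h" "C = (\<lambda>b. h \<cdot>\<^bsub>G\<^esub> b) ` B"
proof -
  show B': "B \<subseteq> star_at G h"
  proof
    fix b assume b: "b \<in> B"
    then have bm: "b \<in> mor G" using B by auto
    have "\<pi> h \<otimes> atom B = (\<pi> h \<otimes> \<epsilon> b) \<otimes> atom B"
      using b bm B h by (simp add: m_assoc eps_atom)
    then have "\<pi> h \<otimes> \<epsilon> b \<noteq> \<zero>" using nz B C by auto
    then have "src G h = trg G b" using pi_eps_zero[OF bm h] by blast
    then show "b \<in> star_at G h" using bm by (simp add: star_at_def)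
  qed
  have C': "trg G c = trg G h" if "c \<in> C" for c
  proof (rule ccontr)
    assume ne: "trg G c \<noteq> trg G h"
    have c: "c \<in> mor G" using that C by auto
    have "atom C \<otimes> (\<pi> h \<otimes> atom B) = (atom C \<otimes> \<epsilon> c) \<otimes> (\<pi> h \<otimes> atom B)"
      using that c C by (simp add: atom_eps)
    also have "\<dots> = atom C \<otimes> ((\<epsilon> c \<otimes> \<pi> h) \<otimes> atom B)"
      using c C h B by (simp add: m_assoc)
    finally show False using nz ne c C h B by (simp add: eps_pi_zero)
  qed
  have iff: "h \<cdot>\<^bsub>G\<^esub> b \<in> C \<longleftrightarrow> b \<in> B" if "b \<in> mor G" "src G h = trg G b" for b
  proof -
    have hb: "h \<cdot>\<^bsub>G\<^esub> b \<in> mor G" using that h by (simp add: cmp_closed)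
    have "(atom C \<otimes> \<epsilon> (h \<cdot>\<^bsub>G\<^esub> b)) \<otimes> (\<pi> h \<otimes> atom B) = atom C \<otimes> (\<epsilon> (h \<cdot>\<^bsub>G\<^esub> b) \<otimes> \<pi> h) \<otimes> atom B"
      using that hb h B C by (simp add: m_assoc)
    also have "\<dots> = atom C \<otimes> (\<pi> h \<otimes> (\<epsilon> b \<otimes> atom B))"
      using pi_eps[OF h that] that hb h B C by (simp add: m_assoc[symmetric])
    finally show ?thesis
      using nz that hb h B C by (auto simp: eps_atom atom_eps split: if_splits)
  qed
  show "C = (\<lambda>b. h \<cdot>\<^bsub>G\<^esub> b) ` B"
  proof
    show "(\<lambda>b. h \<cdot>\<^bsub>G\<^esub> b) ` B \<subseteq> C" using B' iff by (auto simp: star_at_def)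
    show "C \<subseteq> (\<lambda>b. h \<cdot>\<^bsub>G\<^esub> b) ` B"
    proof
      fix c assume c: "c \<in> C"
      then have cm: "c \<in> mor G" "trg G h = trg G c" using C C' by auto
      then have "c = h \<cdot>\<^bsub>G\<^esub> (ginv G h \<cdot>\<^bsub>G\<^esub> c)" using h by (simp add: cmp_cancel_left')
      moreover have "ginv G h \<cdot>\<^bsub>G\<^esub> c \<in> B"
        using iff[of "ginv G h \<cdot>\<^bsub>G\<^esub> c"] c cm h ginv[OF h]
        by (simp add: cmp_closed trg_cmp cmp_cancel_left')
      ultimately show "c \<in> (\<lambda>b. h \<cdot>\<^bsub>G\<^esub> b) ` B" by blast
    qed
  qed
qed

text \<open>By the previous lemma, \<open>atom (h B)\<close> is the only atom whose product with \<open>\<pi> h \<cdot> atom B\<close> from the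
  left can be nonzero, and \<open>atom B\<close> the only one for \<open>atom (h B) \<cdot> \<pi> h\<close> from the right. Hence both
  elements equal \<open>atom (h B) \<cdot> \<pi> h \<cdot> atom B\<close>.\<close>

lemma pi_atom:
  assumes B: "B \<subseteq> star_at G h" and h: "h \<in> mor G"
  shows "\<pi> h \<otimes> atom B = atom ((\<lambda>b. h \<cdot>\<^bsub>G\<^esub> b) ` B) \<otimes> \<pi> h"
proof -
  let ?C = "(\<lambda>b. h \<cdot>\<^bsub>G\<^esub> b) ` B"
  have Bm: "B \<subseteq> mor G" and Cm: "?C \<subseteq> mor G"
    using B h by (auto simp: star_at_def cmp_closed)
  have "atom ?C \<otimes> (\<pi> h \<otimes> atom B) = \<pi> h \<otimes> atom B"
  proof (rule one_sum_absorb_left[OF finite_Pow atom_Pi atom_one])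
    fix D assume "D \<in> Pow (mor G)" "D \<noteq> ?C"
    then show "atom D \<otimes> (\<pi> h \<otimes> atom B) = \<zero>"
      using atom_pi_atom_nonzero(2)[OF Bm _ h, of D] by blast
  qed (use Bm Cm h in auto)
  \<comment> \<open>Left translation by \<open>h\<close> is injective on its star, so \<open>h D = h B\<close> forces \<open>D = B\<close>.\<close>
  moreover have "atom ?C \<otimes> \<pi> h \<otimes> atom B = atom ?C \<otimes> \<pi> h"
  proof (rule one_sum_absorb_right[OF finite_Pow atom_Pi atom_one])
    fix D assume D: "D \<in> Pow (mor G)" "D \<noteq> B"
    have inj: "inj_on (\<lambda>b. h \<cdot>\<^bsub>G\<^esub> b) (star_at G h)"
      using h cmp_cancel_left[of h]
      by (intro inj_on_inverseI[of _ "\<lambda>c. ginv G h \<cdot>\<^bsub>G\<^esub> c"]) (simp add: star_at_def)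
    have "atom ?C \<otimes> (\<pi> h \<otimes> atom D) = \<zero>"
      using atom_pi_atom_nonzero[OF _ Cm h, of D] D inj_on_image_eq_iff[OF inj B, of D] by auto
    then show "atom ?C \<otimes> \<pi> h \<otimes> atom D = \<zero>" using D h Cm by (simp add: m_assoc)
  qed (use Bm Cm h in auto)
  ultimately show ?thesis using Bm Cm h by (simp add: m_assoc)
qed

definition lift where "lift = (\<lambda>(A, g). \<pi> g \<otimes> atom A)"

lemma BR_mem:
  assumes "(A, g) \<in> mor BR"
  shows "g \<in> mor G" "A \<subseteq> mor G" "A \<subseteq> star_at G g" "src G g \<in> A" "ginv G g \<in> A"
  using assms by (auto simp: mor_birget_rhodes star_at_def)

lemma lift_closed: "x \<in> mor BR \<Longrightarrow> lift x \<in> carrier R"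
  by (cases x) (simp add: lift_def BR_mem)

text \<open>After \<open>\<pi> h\<close> has been moved across, orthogonality of the atoms decides whether the product
  vanishes. If it does not, \<open>h\<inverse> \<in> B\<close> supplies the factor \<open>\<epsilon> (h\<inverse>)\<close> that turns \<open>\<pi> g \<cdot> \<pi> h\<close> into
  \<open>\<pi> (g h)\<close>.\<close>

lemma lift_mult:
  assumes A: "(A, g) \<in> mor BR" and B: "(B, h) \<in> mor BR"
  shows "lift (A, g) \<otimes> lift (B, h) =
    (if A = (\<lambda>b. h \<cdot>\<^bsub>G\<^esub> b) ` B \<and> src G g = trg G h then lift (B, g \<cdot>\<^bsub>G\<^esub> h) else \<zero>)"
proof -
  let ?C = "(\<lambda>b. h \<cdot>\<^bsub>G\<^esub> b) ` B"
  note mA = BR_mem[OF A] and mB = BR_mem[OF B]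
  have Cm: "?C \<subseteq> mor G" using mB by (auto simp: star_at_def cmp_closed)
  have "lift (A, g) \<otimes> lift (B, h) = \<pi> g \<otimes> (atom A \<otimes> (\<pi> h \<otimes> atom B))"
    using mA mB by (simp add: lift_def m_assoc)
  also have "\<dots> = \<pi> g \<otimes> (atom A \<otimes> atom ?C \<otimes> \<pi> h)"
    using mA mB Cm by (simp add: pi_atom m_assoc)
  finally have *: "lift (A, g) \<otimes> lift (B, h) = \<pi> g \<otimes> (atom A \<otimes> atom ?C \<otimes> \<pi> h)" .
  show ?thesis
  proof (cases "A = ?C")
    case False
    then show ?thesis using * atom_orth[OF mA(2) Cm] mA mB by simp
  next
    case True
    then obtain b where "b \<in> B" "src G g = h \<cdot>\<^bsub>G\<^esub> b" using mA(4) by auto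
    \<comment> \<open>The object \<open>d g\<close> lies in \<open>A = h B\<close>, hence has the range of \<open>h\<close>.\<close>
    then have gh: "src G g = trg G h"
      using mA(1) mB(1,3) trg_src[OF mA(1)] trg_cmp[of h b] by (auto simp: star_at_def)
    have "lift (A, g) \<otimes> lift (B, h) = \<pi> g \<otimes> (\<pi> h \<otimes> atom B)"
      using * True mB atom_idem[OF Cm] by (simp add: pi_atom)
    also have "\<pi> h \<otimes> atom B = \<pi> h \<otimes> (\<epsilon> (ginv G h) \<otimes> atom B)"
      using mB ginv[OF mB(1)] by (simp add: eps_atom)
    also have "\<pi> g \<otimes> \<dots> = (\<pi> g \<otimes> (\<pi> h \<otimes> \<pi> (ginv G h))) \<otimes> (\<pi> h \<otimes> atom B)"
      using mA mB by (simp add: \<epsilon>_def ginv_ginv m_assoc)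
    also have "\<dots> = \<pi> (g \<cdot>\<^bsub>G\<^esub> h) \<otimes> (\<epsilon> (ginv G h) \<otimes> atom B)"
      using mA mB gh by (simp add: pi_mult_right \<epsilon>_def ginv_ginv m_assoc cmp_closed)
    also have "\<dots> = lift (B, g \<cdot>\<^bsub>G\<^esub> h)"
      using mB ginv[OF mB(1)] by (simp add: eps_atom lift_def)
    finally show ?thesis using True gh by simp
  qed
qed

lemma obj_atom:
  assumes "(A, e) \<in> objs BR"
  shows "lift (A, e) = atom A" "A \<subseteq> mor G"
  using assms eps_atom[of A e]
  by (auto simp: lift_def objs_birget_rhodes star_at_def eps_obj objs_mor subset_iff)

text \<open>An object of the expansion is determined by its set, so the sum over the objects is the sum
  over all atoms without some that vanish.\<close>

lemma lift_one: "(\<Oplus>x\<in>objs BR. lift x) = \<one>"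
proof -
  have inj: "inj_on fst (objs BR)"
  proof (rule inj_onI)
    fix x y assume *: "x \<in> objs BR" "y \<in> objs BR" "fst x = fst y"
    then show "x = y" by (cases x; cases y) (auto simp: objs_birget_rhodes star_at_def objs_src objs_trg)
  qed
  have sub: "fst x \<subseteq> mor G" "lift x = atom (fst x)" if "x \<in> objs BR" for x
    using that obj_atom by (cases x; simp)+
  have "(\<Oplus>x\<in>objs BR. lift x) = (\<Oplus>x\<in>objs BR. atom (fst x))"
    using sub by (intro finsum_cong') auto
  also have "\<dots> = (\<Oplus>A\<in>fst ` objs BR. atom A)"
    using finsum_reindex[of atom fst "objs BR"] inj sub by (simp add: image_subset_iff_funcset[symmetric] image_subset_iff)
  also have "\<dots> = (\<Oplus>A\<in>Pow (mor G). atom A)"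
  proof (rule add.finprod_mono_neutral_cong_left[OF finite_Pow _ _ _ atom_Pi])
    fix A assume "A \<in> Pow (mor G) - fst ` objs BR"
    then show "atom A = \<zero>" using atom_nonzero[of A] by (force simp: image_iff)
  qed (use sub in auto)
  finally show ?thesis by (simp add: atom_one)
qed

lemma groupoid_rep_lift: "groupoid_rep BR R lift"
  unfolding groupoid_rep_def
  using lift_closed lift_one lift_mult by auto

text \<open>The sum over the fibre of \<open>g\<close> extends to all sets \<open>A\<close>, since \<open>\<pi> g \<cdot> atom A\<close> is nonzero only if
  \<open>atom A\<close> is and \<open>g\<inverse> \<in> A\<close>, the latter because \<open>\<pi> g = \<pi> g \<cdot> \<epsilon> (g\<inverse>)\<close>. The atoms add up to \<open>1\<close>.\<close>

lemma partial_of_rep_lift: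
  assumes g: "g \<in> mor G"
  shows "partial_of_rep lift g = \<pi> g"
proof -
  have "partial_of_rep lift g = (\<Oplus>A\<in>{A. (A, g) \<in> mor BR}. \<pi> g \<otimes> atom A)"
    by (simp add: partial_of_rep_def lift_def)
  also have "\<dots> = (\<Oplus>A\<in>Pow (mor G). \<pi> g \<otimes> atom A)"
  proof (rule add.finprod_mono_neutral_cong_left[OF finite_Pow])
    fix A assume A: "A \<in> Pow (mor G) - {A. (A, g) \<in> mor BR}"
    then have Am: "A \<subseteq> mor G" by auto
    have e: "\<pi> g \<otimes> atom A = \<pi> g \<otimes> (\<epsilon> (ginv G g) \<otimes> atom A)"
      using g Am eps_pi[OF g] by (simp add: \<epsilon>_def ginv_ginv m_assoc[symmetric])
    show "\<pi> g \<otimes> atom A = \<zero>"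
    proof (cases "ginv G g \<in> A \<and> atom A \<noteq> \<zero>")
      case True
      then obtain f where f: "(A, f) \<in> objs BR" using atom_nonzero[OF Am] by auto
      then have "trg G (ginv G g) = f" using True
        by (auto simp: objs_birget_rhodes star_at_def objs_src)
      then have "(A, g) \<in> mor BR"
        using f True g ginv[OF g]
        by (auto simp: objs_birget_rhodes mor_birget_rhodes star_at_def objs_src)
      then show ?thesis using A by simp
    next
      case False
      then show ?thesis using g Am e eps_atom[OF Am ginv(1)[OF g]] by (auto split: if_splits)
    qed
  qed (use g in \<open>auto simp: mor_birget_rhodes star_at_def\<close>)
  also have "\<dots> = \<pi> g \<otimes> (\<Oplus>A\<in>Pow (mor G). atom A)"
    using g atom_Pi finite_Pow by (intro finsum_rdistr[symmetric]) auto
  finally show ?thesis using g by (simp add: atom_one)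
qed

end


section \<open>The correspondence\<close>

locale birget_rhodes_algebra =
  fixes G :: "('g, 'x) groupoid_scheme" and K :: "('k, 'm) ring_scheme"
    and A :: "('k, 'a, 'y) module_scheme"
  assumes groupoid_G: "groupoid G" and finite_G: "finite (mor G)"
    and unital_algebra_A: "unital_algebra K A"
begin

sublocale B: finite_groupoid_algebra "birget_rhodes G" K A
  by (intro finite_groupoid_algebra.intro groupoid.groupoid_birget_rhodes
      groupoid.finite_mor_birget_rhodes groupoid_G finite_G unital_algebra_A)

sublocale R: finite_groupoid_ring G A
  using groupoid_G finite_G B.A.ring_axioms
  by (simp add: finite_groupoid_ring_def finite_groupoid_ring_axioms_def)

lemma br_lambda_closed: "br_lambda K G g \<in> carrier (br_algebra K G)"
  unfolding br_lambda_def by (rule B.KH.finsum_closed) (auto simp: B.basis_closed)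

lemma hom_br_lambda:
  assumes "\<phi> \<in> algebra_hom K (br_algebra K G) A"
  shows "\<phi> (br_lambda K G g) = R.partial_of_rep (\<lambda>x. \<phi> (basis_elt K x)) g"
proof -
  have "{X. ginv G g \<in> X \<and> (X, g) \<in> mor (birget_rhodes G)} = {X. (X, g) \<in> mor (birget_rhodes G)}"
    by (auto simp: R.mor_birget_rhodes)
  then show ?thesis
    unfolding br_lambda_def R.partial_of_rep_def
    by (subst B.hom_finsum[OF assms]) (auto simp: B.basis_closed)
qed

lemma partial_rep_of_hom:
  assumes "\<phi> \<in> algebra_hom K (br_algebra K G) A"
  shows "partial_groupoid_rep G A (\<lambda>g. \<phi> (br_lambda K G g))"
proof -
  interpret birget_rhodes_rep G A "\<lambda>x. \<phi> (basis_elt K x)"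
    by unfold_locales (rule B.groupoid_rep_of_hom[OF assms])
  show ?thesis using partial_groupoid_rep by (simp add: hom_br_lambda[OF assms])
qed

lemma hom_of_partial_rep:
  assumes "partial_groupoid_rep G A \<pi>"
  shows "\<exists>\<phi>\<in>algebra_hom K (br_algebra K G) A. \<forall>g\<in>mor G. \<pi> g = \<phi> (br_lambda K G g)"
proof -
  interpret partial_rep G A \<pi> by unfold_locales fact
  let ?\<phi> = "B.linear_ext lift"
  have hom: "?\<phi> \<in> algebra_hom K (br_algebra K G) A" by (rule B.linear_ext_hom[OF groupoid_rep_lift])
  have "\<pi> g = ?\<phi> (br_lambda K G g)" if "g \<in> mor G" for g
  proof -
    have "?\<phi> (br_lambda K G g) = R.partial_of_rep (\<lambda>x. ?\<phi> (basis_elt K x)) g"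
      by (rule hom_br_lambda[OF hom])
    also have "\<dots> = R.partial_of_rep lift g"
      unfolding R.partial_of_rep_def using lift_closed
      by (intro B.A.finsum_cong') (auto simp: B.linear_ext_basis)
    finally show ?thesis by (simp add: partial_of_rep_lift that)
  qed
  then show ?thesis using hom by blast
qed

text \<open>A homomorphism is determined by its values on the basis, and these form a representation of
  the expansion, which is determined by its partial representation.\<close>

lemma hom_eqI:
  assumes "\<phi> \<in> algebra_hom K (br_algebra K G) A" "\<psi> \<in> algebra_hom K (br_algebra K G) A"
    and "\<And>g. g \<in> mor G \<Longrightarrow> \<phi> (br_lambda K G g) = \<psi> (br_lambda K G g)"
    and "f \<in> carrier (br_algebra K G)"
  shows "\<phi> f = \<psi> f"
proof -
  note reps = assms(1,2)[THEN B.groupoid_rep_of_hom]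
  have "\<phi> (basis_elt K x) = \<psi> (basis_elt K x)" if "x \<in> mor (birget_rhodes G)" for x
    using R.rep_eq_of_partial_eq[OF reps _ that] assms(3) hom_br_lambda[OF assms(1)]
      hom_br_lambda[OF assms(2)] by simp
  moreover have "(\<lambda>x. f x \<odot>\<^bsub>A\<^esub> \<psi> (basis_elt K x)) \<in> mor (birget_rhodes G) \<rightarrow> carrier A"
    using reps(2) assms(4) by (auto simp: groupoid_rep_def B.carrier_KH)
  ultimately show ?thesis
    unfolding B.algebra_hom_expansion[OF assms(1,4)] B.algebra_hom_expansion[OF assms(2,4)]
    by (intro B.A.finsum_cong') auto
qed

end

text \<open>The values of \<open>\<pi>\<close> outside \<open>mor G\<close> are arbitrary, so maps that agree on \<open>mor G\<close> have to be
  interchangeable.\<close>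

lemma partial_groupoid_rep_cong:
  assumes "groupoid G" "\<And>g. g \<in> mor G \<Longrightarrow> \<pi> g = \<pi>' g" "partial_groupoid_rep G A \<pi>"
    and "ring A"
  shows "partial_groupoid_rep G A \<pi>'"
proof -
  interpret groupoid G by fact
  interpret A: ring A by fact
  have "(\<Oplus>\<^bsub>A\<^esub>e\<in>objs G. \<pi> e) = (\<Oplus>\<^bsub>A\<^esub>e\<in>objs G. \<pi>' e)"
    using assms(2,3) by (intro A.finsum_cong') (auto simp: partial_groupoid_rep_def objs_mor Pi_def)
  then show ?thesis
    using assms(2,3) by (simp add: partial_groupoid_rep_def Pi_def ginv cmp_closed objs_mor)
qed

theorem theorem3p2:
  fixes G :: "'g groupoid" and K :: "'k ring" and A :: "('k, 'a) module"
  assumes "groupoid G" and "finite (mor G)" and "field K" and "unital_algebra K A"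
  shows "bij_betw (\<lambda>\<phi>. restrict (\<phi> \<circ> br_lambda K G) (mor G))
           (algebra_hom K (br_algebra K G) A \<inter> extensional (carrier (br_algebra K G)))
           ({\<pi>. partial_groupoid_rep G A \<pi>} \<inter> extensional (mor G)) \<and>
         (\<forall>\<pi> \<in> mor G \<rightarrow> carrier A.
           (partial_groupoid_rep G A \<pi> \<longleftrightarrow>
             (\<exists>\<phi> \<in> algebra_hom K (br_algebra K G) A. \<forall>g\<in>mor G. \<pi> g = \<phi> (br_lambda K G g))) \<and>
           (\<forall>\<phi> \<in> algebra_hom K (br_algebra K G) A. \<forall>\<psi> \<in> algebra_hom K (br_algebra K G) A.
             (\<forall>g\<in>mor G. \<pi> g = \<phi> (br_lambda K G g)) \<longrightarrow>
             (\<forall>g\<in>mor G. \<pi> g = \<psi> (br_lambda K G g)) \<longrightarrow>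
             (\<forall>x\<in>carrier (br_algebra K G). \<phi> x = \<psi> x)))"
proof (intro conjI ballI impI)
  interpret birget_rhodes_algebra G K A by (rule birget_rhodes_algebra.intro) fact+
  let ?KB = "br_algebra K G"
  note cong = partial_groupoid_rep_cong[OF assms(1) _ _ B.A.ring_axioms]
  show "bij_betw (\<lambda>\<phi>. restrict (\<phi> \<circ> br_lambda K G) (mor G))
           (algebra_hom K ?KB A \<inter> extensional (carrier ?KB))
           ({\<pi>. partial_groupoid_rep G A \<pi>} \<inter> extensional (mor G))"
  proof (intro bij_betw_imageI inj_onI equalityI subsetI)
    fix \<phi> \<psi>
    assume \<phi>: "\<phi> \<in> algebra_hom K ?KB A \<inter> extensional (carrier ?KB)"
      and \<psi>: "\<psi> \<in> algebra_hom K ?KB A \<inter> extensional (carrier ?KB)"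
      and eq: "restrict (\<phi> \<circ> br_lambda K G) (mor G) = restrict (\<psi> \<circ> br_lambda K G) (mor G)"
    have "\<phi> (br_lambda K G g) = \<psi> (br_lambda K G g)" if "g \<in> mor G" for g
      using fun_cong[OF eq, of g] that by simp
    note agree = this
    show "\<phi> = \<psi>"
    proof (rule extensionalityI)
      show "\<phi> \<in> extensional (carrier ?KB)" "\<psi> \<in> extensional (carrier ?KB)"
        using \<phi> \<psi> by simp_all
      show "\<phi> f = \<psi> f" if "f \<in> carrier ?KB" for f
        by (rule hom_eqI[OF IntD1[OF \<phi>] IntD1[OF \<psi>] agree that])
    qed
  next
    fix \<pi> assume "\<pi> \<in> (\<lambda>\<phi>. restrict (\<phi> \<circ> br_lambda K G) (mor G)) `
        (algebra_hom K ?KB A \<inter> extensional (carrier ?KB))"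
    then obtain \<phi> where \<phi>: "\<phi> \<in> algebra_hom K ?KB A"
        "\<pi> = restrict (\<phi> \<circ> br_lambda K G) (mor G)" by blast
    have "partial_groupoid_rep G A \<pi>"
      by (rule cong[OF _ partial_rep_of_hom[OF \<phi>(1)]]) (simp add: \<phi>(2))
    then show "\<pi> \<in> {\<pi>. partial_groupoid_rep G A \<pi>} \<inter> extensional (mor G)"
      using \<phi>(2) by simp
  next
    fix \<pi> assume \<pi>: "\<pi> \<in> {\<pi>. partial_groupoid_rep G A \<pi>} \<inter> extensional (mor G)"
    then obtain \<phi> where \<phi>: "\<phi> \<in> algebra_hom K ?KB A"
        "\<And>g. g \<in> mor G \<Longrightarrow> \<pi> g = \<phi> (br_lambda K G g)"
      using hom_of_partial_rep[of \<pi>] by auto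
    have "\<pi> = restrict (restrict \<phi> (carrier ?KB) \<circ> br_lambda K G) (mor G)"
      using \<phi>(2) \<pi> br_lambda_closed by (intro extensionalityI[of _ "mor G"]) auto
    then show "\<pi> \<in> (\<lambda>\<phi>. restrict (\<phi> \<circ> br_lambda K G) (mor G)) `
        (algebra_hom K ?KB A \<inter> extensional (carrier ?KB))"
      using B.restrict_hom[OF \<phi>(1)] by (intro image_eqI) auto
  qed
  fix \<pi> assume "\<pi> \<in> mor G \<rightarrow> carrier A"
  show "partial_groupoid_rep G A \<pi> \<longleftrightarrow>
      (\<exists>\<phi> \<in> algebra_hom K ?KB A. \<forall>g\<in>mor G. \<pi> g = \<phi> (br_lambda K G g))"
  proof
    assume "partial_groupoid_rep G A \<pi>"
    then show "\<exists>\<phi> \<in> algebra_hom K ?KB A. \<forall>g\<in>mor G. \<pi> g = \<phi> (br_lambda K G g)"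
      by (rule hom_of_partial_rep)
  next
    assume "\<exists>\<phi> \<in> algebra_hom K ?KB A. \<forall>g\<in>mor G. \<pi> g = \<phi> (br_lambda K G g)"
    then obtain \<phi> where \<phi>: "\<phi> \<in> algebra_hom K ?KB A"
        "\<forall>g\<in>mor G. \<pi> g = \<phi> (br_lambda K G g)" by blast
    show "partial_groupoid_rep G A \<pi>"
      by (rule cong[OF _ partial_rep_of_hom[OF \<phi>(1)]]) (simp add: \<phi>(2))
  qed
  show "\<phi> x = \<psi> x" if "\<phi> \<in> algebra_hom K ?KB A" "\<psi> \<in> algebra_hom K ?KB A"
    "\<forall>g\<in>mor G. \<pi> g = \<phi> (br_lambda K G g)" "\<forall>g\<in>mor G. \<pi> g = \<psi> (br_lambda K G g)"
    "x \<in> carrier ?KB" for \<phi> \<psi> x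
    using hom_eqI[of \<phi> \<psi> x] that by simp
qed

end
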